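(* Let $(\epsilon,\epsilon')\in\{(0,1),(1,0),(0,0),(1,1)\}$ and let $(\lambda,\mu)$ be a pair of partitions in $\mathcal P_{\epsilon,\epsilon'}(N)$ corresponding to a minimal special degeneration. Then $(\lambda,\mu)$ is equivalent to a unique entry of the following list; that is, removing all common initial rows ($l$ of them) and all common initial columns ($s$ of them) turns $(\lambda,\mu)$ into exactly one of the following pairs $(\bar\lambda,\bar\mu)$, with the indicated parity conditions on $l$ and $s$ (all congruences modulo $2$): Codimension two: - type $a$ (in $\mathfrak{sp}_2$): $([2],[1,1])$, with $l\equiv\epsilon'$, $s\not\equiv\epsilon$; - type $b$ (in $\mathfrak{sp}_{2n}$, $n\ge2$): $([2n],[2n-2,2])$, with $l$ arbitrary, $s\not\equiv\epsilon$; - type $c$ (in $\mathfrak{so}_{2n+1}$, $n\ge1$): $([2n+1],[2n-1,1,1])$, with $l\not\equiv\epsilon'$, $s\equiv\epsilon$; - type $d$ (in $\mathfrak{sp}_{4n+2}$, $n\ge1$): $([2n+1,2n+1],[2n,2n,2])$, with $l\equiv\epsilon'$, $s\not\equiv\epsilon$; - type $e$ (in $\mathfrak{so}_{4n}$, $n\ge1$): $([2n,2n],[2n-1,2n-1,1,1])$, with $l\equiv\epsilon'$, $s\equiv\epsilon$. Codimension at least four: - type $g_{sp}$ (in $\mathfrak{sp}_{2n}$, $n\ge2$): $([2^2,1^{2n-4}],[1^{2n}])$, with $l\equiv\epsilon'$, $s\not\equiv\epsilon$; - type $h$ (in $\mathfrak{so}_{2n}$, $n\ge3$): $([2^2,1^{2n-4}],[1^{2n}])$,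 with $l\equiv\epsilon'$, $s\equiv\epsilon$; - type $f^1_{sp}$ (in $\mathfrak{so}_{2n+1}$, $n\ge2$): $([3,1^{2n-2}],[1^{2n+1}])$, with $l\not\equiv\epsilon'$, $s\equiv\epsilon$; - type $f^2_{sp}$ (in $\mathfrak{sp}_{4n+2}$, $n\ge2$): $([3^2,2^{2n-2}],[2^{2n+1}])$, with $l\equiv\epsilon'$, $s\not\equiv\epsilon$; - type $h_{sp}$ (in $\mathfrak{sp}_{4n}$, $n\ge2$): $([4,2^{2n-2}],[2^{2n}])$, with $l\not\equiv\epsilon'$, $s\not\equiv\epsilon$.
   Context: For a partition $\lambda$, $m_\lambda(s)$ is the multiplicity of the part $s$ and $h_\lambda(s)=\#\{j:\lambda_j\ge s\}$. $\mathcal P_\epsilon(N)$ is the set of partitions of $N$ in which every part $s\equiv\epsilon \pmod 2$ has even multiplicity. $\mathcal P_{\epsilon,\epsilon'}(N)$ is the set of $\lambda\in\mathcal P_\epsilon(N)$ with $h_\lambda(s)\equiv\epsilon'\pmod 2$ for every part $s\equiv\epsilon$, where $s=0$ is counted as a part (with $h_\lambda(0)$ the number of positive parts). Nonempty cases: $(0,1)$ with $N$ odd (special orbits of type $B$, in $\mathfrak{so}_N$), $(1,0)$ with $N$ even (special orbits of type $C$, in $\mathfrak{sp}_N$), $(0,0)$ with $N$ even (special orbits of type $D$, under the full orthogonal group, in $\mathfrak{so}_N$), and $(1,1)$ with $N$ even (the "alternative special" orbits in $\mathfrak{sp}_N$). These sets are ordered by the dominance order. A minimal special degeneration is a pair $(\lambda,\mu)$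 in $\mathcal P_{\epsilon,\epsilon'}(N)$ with $\mu<\lambda$ and no element of $\mathcal P_{\epsilon,\epsilon'}(N)$ strictly between. Removing common initial rows/columns: view partitions as Young diagrams with rows $\lambda_i$. Let $l$ be the number of leading rows with $\lambda_i=\mu_i$ that are deleted (the maximal number), and then let $s$ be the maximal number of leading columns that coincide, which are also deleted. The resulting pair consists of partitions of a common integer which are $\tilde\epsilon$-partitions with $\tilde\epsilon\equiv\epsilon+s$. *)

theory Defs
  imports Complex_Main "HOL-Number_Theory.Cong"
begin

text \<open>
  Partitions are weakly decreasing lists of positive integers. List positions start at \<open>0\<close>,
  so the part usually written with index \<open>i\<close> is \<open>lam ! (i - 1)\<close>.
\<close>

definition partition_of :: "nat \<Rightarrow> nat list \<Rightarrow> bool" where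
  "partition_of N lam \<longleftrightarrow> sorted_wrt (\<ge>) lam \<and> 0 \<notin> set lam \<and> sum_list lam = N"

definition mult :: "nat list \<Rightarrow> nat \<Rightarrow> nat" where
  "mult lam s = card {j. j < length lam \<and> lam ! j = s}"

text \<open>For \<open>s \<ge> 1\<close> this is also the length of column \<open>s\<close> of the Young diagram; \<open>height lam 0\<close>
  is the number of positive parts.\<close>

definition height :: "nat list \<Rightarrow> nat \<Rightarrow> nat" where
  "height lam s = card {j. j < length lam \<and> lam ! j \<ge> s}"

definition eps_partitions :: "nat \<Rightarrow> nat \<Rightarrow> nat list set" where
  "eps_partitions \<epsilon> N = {lam. partition_of N lam \<and>
     (\<forall>s\<in>set lam. [s = \<epsilon>] (mod 2) \<longrightarrow> even (mult lam s))}"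

definition special_partitions :: "nat \<Rightarrow> nat \<Rightarrow> nat \<Rightarrow> nat list set" where
  "special_partitions \<epsilon> \<epsilon>' N = {lam \<in> eps_partitions \<epsilon> N.
     \<forall>s\<in>insert 0 (set lam). [s = \<epsilon>] (mod 2) \<longrightarrow> [height lam s = \<epsilon>'] (mod 2)}"

text \<open>Strict dominance order; \<open>take k\<close> of a list shorter than \<open>k\<close> is the whole list, which
  amounts to padding partitions by zeros.\<close>

definition dom_less :: "nat list \<Rightarrow> nat list \<Rightarrow> bool" where
  "dom_less mu lam \<longleftrightarrow> mu \<noteq> lam \<and> (\<forall>k. sum_list (take k mu) \<le> sum_list (take k lam))"

definition minimal_special_degeneration ::
  "nat \<Rightarrow> nat \<Rightarrow> nat \<Rightarrow> nat list \<Rightarrow> nat list \<Rightarrow> bool" where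
  "minimal_special_degeneration \<epsilon> \<epsilon>' N lam mu \<longleftrightarrow>
     lam \<in> special_partitions \<epsilon> \<epsilon>' N \<and> mu \<in> special_partitions \<epsilon> \<epsilon>' N \<and> dom_less mu lam \<and>
     \<not> (\<exists>nu\<in>special_partitions \<epsilon> \<epsilon>' N. dom_less mu nu \<and> dom_less nu lam)"

definition common_rows :: "nat list \<Rightarrow> nat list \<Rightarrow> nat" where
  "common_rows lam mu =
     (GREATEST l. l \<le> length lam \<and> l \<le> length mu \<and> (\<forall>i<l. lam ! i = mu ! i))"

text \<open>The set of admissible \<open>s\<close> is bounded only for distinct partitions, which is the only case
  used.\<close>

definition common_cols :: "nat list \<Rightarrow> nat list \<Rightarrow> nat" where
  "common_cols lam mu = (GREATEST s. \<forall>j\<in>{1..s}. height lam j = height mu j)"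

definition remove_cols :: "nat \<Rightarrow> nat list \<Rightarrow> nat list" where
  "remove_cols s lam = filter (\<lambda>x. 0 < x) (map (\<lambda>x. x - s) lam)"

datatype degeneration_type =
    Type_a | Type_b nat | Type_c nat | Type_d nat | Type_e nat
  | Type_g_sp nat | Type_h nat | Type_f1_sp nat | Type_f2_sp nat | Type_h_sp nat

text \<open>\<open>is_entry t \<epsilon> \<epsilon>' l s lam mu\<close>: deleting \<open>l\<close> rows and \<open>s\<close> columns from a pair of
  \<open>(\<epsilon>, \<epsilon>')\<close>-special partitions has left the pair \<open>(lam, mu)\<close>, and this is the entry \<open>t\<close>. In
  every equation the bound on \<open>n\<close> makes the truncated subtractions exact.\<close>

fun is_entry ::
  "degeneration_type \<Rightarrow> nat \<Rightarrow> nat \<Rightarrow> nat \<Rightarrow> nat \<Rightarrow> nat list \<Rightarrow> nat list \<Rightarrow> bool" where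
  "is_entry Type_a \<epsilon> \<epsilon>' l s lam mu \<longleftrightarrow>
     lam = [2] \<and> mu = [1, 1] \<and>
     [l = \<epsilon>'] (mod 2) \<and> \<not> [s = \<epsilon>] (mod 2)"
| "is_entry (Type_b n) \<epsilon> \<epsilon>' l s lam mu \<longleftrightarrow>
     n \<ge> 2 \<and> lam = [2*n] \<and> mu = [2*n - 2, 2] \<and>
     \<not> [s = \<epsilon>] (mod 2)"
| "is_entry (Type_c n) \<epsilon> \<epsilon>' l s lam mu \<longleftrightarrow>
     n \<ge> 1 \<and> lam = [2*n + 1] \<and> mu = [2*n - 1, 1, 1] \<and>
     \<not> [l = \<epsilon>'] (mod 2) \<and> [s = \<epsilon>] (mod 2)"
| "is_entry (Type_d n) \<epsilon> \<epsilon>' l s lam mu \<longleftrightarrow>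
     n \<ge> 1 \<and> lam = [2*n + 1, 2*n + 1] \<and> mu = [2*n, 2*n, 2] \<and>
     [l = \<epsilon>'] (mod 2) \<and> \<not> [s = \<epsilon>] (mod 2)"
| "is_entry (Type_e n) \<epsilon> \<epsilon>' l s lam mu \<longleftrightarrow>
     n \<ge> 1 \<and> lam = [2*n, 2*n] \<and> mu = [2*n - 1, 2*n - 1, 1, 1] \<and>
     [l = \<epsilon>'] (mod 2) \<and> [s = \<epsilon>] (mod 2)"
| "is_entry (Type_g_sp n) \<epsilon> \<epsilon>' l s lam mu \<longleftrightarrow>
     n \<ge> 2 \<and> lam = [2, 2] @ replicate (2*n - 4) 1 \<and> mu = replicate (2*n) 1 \<and>
     [l = \<epsilon>'] (mod 2) \<and> \<not> [s = \<epsilon>] (mod 2)"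
| "is_entry (Type_h n) \<epsilon> \<epsilon>' l s lam mu \<longleftrightarrow>
     n \<ge> 3 \<and> lam = [2, 2] @ replicate (2*n - 4) 1 \<and> mu = replicate (2*n) 1 \<and>
     [l = \<epsilon>'] (mod 2) \<and> [s = \<epsilon>] (mod 2)"
| "is_entry (Type_f1_sp n) \<epsilon> \<epsilon>' l s lam mu \<longleftrightarrow>
     n \<ge> 2 \<and> lam = [3] @ replicate (2*n - 2) 1 \<and> mu = replicate (2*n + 1) 1 \<and>
     \<not> [l = \<epsilon>'] (mod 2) \<and> [s = \<epsilon>] (mod 2)"
| "is_entry (Type_f2_sp n) \<epsilon> \<epsilon>' l s lam mu \<longleftrightarrow>
     n \<ge> 2 \<and> lam = [3, 3] @ replicate (2*n - 2) 2 \<and> mu = replicate (2*n + 1) 2 \<and>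
     [l = \<epsilon>'] (mod 2) \<and> \<not> [s = \<epsilon>] (mod 2)"
| "is_entry (Type_h_sp n) \<epsilon> \<epsilon>' l s lam mu \<longleftrightarrow>
     n \<ge> 2 \<and> lam = [4] @ replicate (2*n - 2) 2 \<and> mu = replicate (2*n) 2 \<and>
     \<not> [l = \<epsilon>'] (mod 2) \<and> \<not> [s = \<epsilon>] (mod 2)"

text \<open>The Lie algebra in which an entry lives: \<open>(0, M)\<close> stands for \<open>so\<close> of \<open>M \<times> M\<close>
  matrices and \<open>(1, M)\<close> for \<open>sp\<close> of \<open>M \<times> M\<close> matrices, so that nilpotent orbits of \<open>(\<epsilon>, M)\<close> are
  indexed by \<^term>\<open>eps_partitions \<epsilon> M\<close>.\<close>

fun ambient :: "degeneration_type \<Rightarrow> nat \<times> nat" where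
  "ambient Type_a = (1, 2)"
| "ambient (Type_b n) = (1, 2*n)"
| "ambient (Type_c n) = (0, 2*n + 1)"
| "ambient (Type_d n) = (1, 4*n + 2)"
| "ambient (Type_e n) = (0, 4*n)"
| "ambient (Type_g_sp n) = (1, 2*n)"
| "ambient (Type_h n) = (0, 2*n)"
| "ambient (Type_f1_sp n) = (0, 2*n + 1)"
| "ambient (Type_f2_sp n) = (1, 4*n + 2)"
| "ambient (Type_h_sp n) = (1, 4*n)"

fun codim_two_type :: "degeneration_type \<Rightarrow> bool" where
  "codim_two_type Type_a \<longleftrightarrow> True"
| "codim_two_type (Type_b n) \<longleftrightarrow> True"
| "codim_two_type (Type_c n) \<longleftrightarrow> True"
| "codim_two_type (Type_d n) \<longleftrightarrow> True"
| "codim_two_type (Type_e n) \<longleftrightarrow> True"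
| "codim_two_type _ \<longleftrightarrow> False"

text \<open>
  Complex dimension of the nilpotent orbit with partition \<open>lam\<close> of \<open>N\<close>, under the orthogonal
  group (\<open>\<epsilon> = 0\<close>) or the symplectic group (\<open>\<epsilon> = 1\<close>), by the classical formula
  \<open>dim O = N (N \<mp> 1) / 2 - ((\<Sum>j. h(j)\<^sup>2) \<mp> #{j. lam\<^sub>j odd}) / 2\<close>
  (upper signs for \<open>\<epsilon> = 0\<close>; Collingwood--McGovern, Corollary 6.1.4).
\<close>

definition orbit_dim :: "nat \<Rightarrow> nat list \<Rightarrow> rat" where
  "orbit_dim \<epsilon> lam =
     (let N = of_nat (sum_list lam);
          sq = of_nat (\<Sum>j=1..sum_list lam. (height lam j)\<^sup>2);
          odds = of_nat (card {j. j < length lam \<and> odd (lam ! j)})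
      in if \<epsilon> = 0 then N * (N - 1) / 2 - (sq - odds) / 2
         else N * (N + 1) / 2 - (sq + odds) / 2)"

definition orbit_codim :: "nat \<Rightarrow> nat list \<Rightarrow> nat list \<Rightarrow> rat" where
  "orbit_codim \<epsilon> lam mu = orbit_dim \<epsilon> lam - orbit_dim \<epsilon> mu"

end

theory Submission
  imports Defs
begin

text \<open>
  Pad a partition by zeros to a sequence of rows \<open>g 0 \<ge> g 1 \<ge> \<dots>\<close>, call a value good if it is
  incongruent to \<open>\<epsilon>\<close> modulo 2 and bad otherwise, and couple the rows \<open>i\<close> and \<open>i + 1\<close> whenever
  \<open>i \<equiv> \<epsilon>'\<close>. A block of a positive bad value has even length and the first index after it has parity
  \<open>\<epsilon>'\<close>; if \<open>0\<close> is bad, the tail of zeros starts at such an index. So these blocks are unions of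
  couples. Hence a partition is special exactly when each couple consists of two equal or
  of two good values and row \<open>0\<close>, if it is left single, is good.
  Speciality is thus a condition on couples, and the number of boxes above the end of a couple has a
  fixed parity.

  Let \<open>g\<close> and \<open>h\<close> be the rows of \<open>\<lambda>\<close> and \<open>\<mu>\<close>, let \<open>l\<close> be the first row in which they differ and
  \<open>a = g l\<close>. Taking two boxes of \<open>\<lambda>\<close> from one good row (or one from each row of a couple) and putting
  them back at the first lower row that has room for them gives again a special partition, where the
  shape of \<open>\<lambda>\<close> allows it. The result dominates \<open>\<mu>\<close> as soon as the gap between the partial sums of
  \<open>g\<close> and \<open>h\<close> is at least the number of boxes in transit; this is where the parity of the gap at the ends of couples enters.
  By minimality such a partition is \<open>\<mu>\<close> itself, so a move that leaves row \<open>l\<close> alone cannot exist.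
  This principle is in the lemmas \<open>refill\<close>, \<open>drop_one\<close>, \<open>drop_pair\<close> and \<open>level\<close>.

  It remains to look at the rows from \<open>l\<close> on. Once the configurations with a move strictly below the
  plateau of height \<open>a\<close> that would block it are excluded, a move that starts at the end of the plateau
  is possible, so \<open>\<mu>\<close> is its result and the plateau is a single row or a single couple. If the
  rows between the start and the target of the move admitted a move of their own, row \<open>l\<close> would be left
  alone; this bounds \<open>a\<close> in terms of the value \<open>s\<close> of the row that receives the boxes. The three
  cases of row \<open>l\<close> being second in its couple or single (\<open>classified_unpaired\<close>), first and bad
  (\<open>classified_bad_pair\<close>), or first and good (\<open>classified_split_pair\<close>, \<open>classified_good_pair\<close>)
  yield the ten entries. The columns common to both diagrams below row \<open>l\<close> are the first \<open>s\<close> ones,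
  which turns the local picture into the entry of the list.

  For the dimensions, \<open>\<Sum>j. h(j)\<^sup>2\<close> equals \<open>\<Sum>i. (2 i + 1) g i\<close>. Twice the codimension is
  therefore the difference of a sum over rows, which changes only at the rows that a move touches.
\<close>

section \<open>Special partitions as padded row sequences\<close>

definition row :: "nat list \<Rightarrow> nat \<Rightarrow> nat" where
  "row xs i = (if i < length xs then xs ! i else 0)"

definition psum :: "(nat \<Rightarrow> nat) \<Rightarrow> nat \<Rightarrow> int" where
  "psum g t = (\<Sum>i<t. int (g i))"

text \<open>Here \<open>e\<close> and \<open>f\<close> stand for \<open>\<epsilon>\<close> and \<open>\<epsilon>'\<close> and matter modulo 2 only. For odd \<open>f\<close>, row \<open>0\<close>
  belongs to no couple and must be good, as if it were coupled with an infinite row above it.\<close>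

definition special_seq :: "nat \<Rightarrow> nat \<Rightarrow> (nat \<Rightarrow> nat) \<Rightarrow> bool" where
  "special_seq e f g \<longleftrightarrow>
     (\<forall>i. g (Suc i) \<le> g i) \<and> (\<exists>n. g n = 0) \<and>
     (\<forall>i. even (i + f) \<longrightarrow> g i = g (Suc i) \<or> odd (e + g i) \<and> odd (e + g (Suc i))) \<and>
     (odd f \<longrightarrow> odd (e + g 0))"

lemma psum_0 [simp]: "psum g 0 = 0"
  by (simp add: psum_def)

lemma psum_Suc [simp]: "psum g (Suc t) = psum g t + int (g t)"
  by (simp add: psum_def)

lemma psum_fun_upd:
  "psum (g(p := v)) t = psum g t + (if p < t then int v - int (g p) else 0)"
  by (induction t) (auto simp: less_Suc_eq)

lemma sum_list_take_eq_psum: "int (sum_list (take k xs)) = psum (row xs) k"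
proof (induction k)
  case (Suc k)
  then show ?case
    by (cases "k < length xs") (auto simp: take_Suc_conv_app_nth row_def)
qed simp

lemma partition_of_row_antimono:
  assumes "partition_of N lam" "i \<le> j"
  shows "row lam j \<le> row lam i"
  using assms sorted_wrt_nth_less[of "(\<ge>)" lam i j]
  by (cases "i = j") (auto simp: row_def partition_of_def)

lemma row_pos_iff:
  assumes "partition_of N lam"
  shows "0 < row lam i \<longleftrightarrow> i < length lam"
proof -
  have "lam ! i \<noteq> 0" if "i < length lam"
    using assms nth_mem[OF that] by (metis partition_of_def)
  then show ?thesis
    by (simp add: row_def)
qed

lemma row_inject:
  assumes "partition_of N lam" "partition_of M mu" "row lam = row mu"
  shows "lam = mu"
proof -
  have "i < length lam \<longleftrightarrow> i < length mu" for i
    using row_pos_iff[OF assms(1), of i] row_pos_iff[OF assms(2), of i] assms(3) by simp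
  then have "length lam = length mu"
    by (metis less_irrefl nat_neq_iff)
  moreover have "lam ! i = mu ! i" if "i < length lam" "i < length mu" for i
    using that assms(3) by (metis row_def)
  ultimately show ?thesis
    by (intro nth_equalityI) auto
qed

text \<open>Applied to the rows of length at least \<open>s\<close>, this turns statements about heights into statements
  about row indices.\<close>

lemma nat_down_set_eq:
  fixes A :: "nat set"
  assumes "finite A" "\<And>i j. j \<in> A \<Longrightarrow> i \<le> j \<Longrightarrow> i \<in> A"
  shows "A = {..<card A}"
proof (cases "A = {}")
  case False
  have "A = {..Max A}"
    using assms(1) False assms(2)[OF Max_in[OF assms(1) False]] by (auto intro: Max_ge)
  then have "card A = Suc (Max A)"
    by (metis card_atMost)
  with \<open>A = {..Max A}\<close> show ?thesis
    by (metis lessThan_Suc_atMost)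
qed simp

lemma less_height_iff:
  assumes "partition_of N lam" "0 < s"
  shows "j < height lam s \<longleftrightarrow> s \<le> row lam j"
proof -
  let ?A = "{j. j < length lam \<and> lam ! j \<ge> s}"
  have A: "j \<in> ?A \<longleftrightarrow> s \<le> row lam j" for j
    using assms(2) by (simp add: row_def)
  have "?A = {..<card ?A}"
  proof (rule nat_down_set_eq)
    fix i j assume "j \<in> ?A" "i \<le> j"
    then show "i \<in> ?A"
      unfolding A using partition_of_row_antimono[OF assms(1)] le_trans by blast
  qed simp
  then have "j < height lam s \<longleftrightarrow> j \<in> ?A"
    unfolding height_def by blast
  then show ?thesis
    unfolding A .
qed

lemma height_eqI:
  assumes "partition_of N lam" "0 < s" "\<And>j. s \<le> row lam j \<longleftrightarrow> j < k"
  shows "height lam s = k"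
  using less_height_iff[OF assms(1,2)] assms(3) by (metis less_irrefl nat_neq_iff)

lemma cong_2_iff: "[a = b] (mod 2) \<longleftrightarrow> even (a + b)" for a b :: nat
  unfolding cong_def by presburger

lemma height_0 [simp]: "height lam 0 = length lam"
  by (simp add: height_def)

lemma height_1:
  assumes "partition_of N lam"
  shows "height lam (Suc 0) = length lam"
  using row_pos_iff[OF assms] by (intro height_eqI[OF assms]) (auto simp: Suc_le_eq)

lemma height_Suc_add_mult: "height lam s = height lam (Suc s) + mult lam s"
proof -
  have "{j. j < length lam \<and> lam ! j \<ge> s} =
        {j. j < length lam \<and> lam ! j \<ge> Suc s} \<union> {j. j < length lam \<and> lam ! j = s}"
    by auto
  moreover have "card \<dots> = height lam (Suc s) + mult lam s"
    unfolding height_def mult_def by (intro card_Un_disjoint) auto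
  ultimately show ?thesis
    unfolding height_def by simp
qed

text \<open>If the rows of a couple \<open>(i, i + 1)\<close> differ, then \<open>i + 1\<close> is both the height of the value of row
  \<open>i\<close> and the number of rows strictly above the value of row \<open>i + 1\<close>. Both numbers have the parity of
  \<open>f\<close> when the value in question is bad, whereas \<open>i + 1\<close> has the other parity.\<close>

lemma special_seq_row:
  assumes "lam \<in> special_partitions e f N"
  shows "special_seq e f (row lam)"
proof -
  have part: "partition_of N lam"
    and ep: "\<forall>s\<in>set lam. even (s + e) \<longrightarrow> even (mult lam s)"
    and hp: "\<forall>s\<in>insert 0 (set lam). even (s + e) \<longrightarrow> even (height lam s + f)"
    using assms unfolding special_partitions_def eps_partitions_def cong_2_iff by simp_all
  have mult: "even (mult lam s)" if "s \<in> set lam" "even (e + s)" for s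
    using ep that by (metis add.commute)
  have hgt: "even (f + height lam s)" if "s = 0 \<or> s \<in> set lam" "even (e + s)" for s
    using hp that by (metis add.commute insert_iff)
  note hiff = less_height_iff[OF part]
  have mem: "row lam i \<in> set lam" if "0 < row lam i" for i
    using that by (auto simp: row_def split: if_splits)
  \<comment> \<open>also the number of rows strictly above a bad value has the parity of \<open>f\<close>\<close>
  have above: "even (f + height lam (Suc v))" if "v = 0 \<or> v \<in> set lam" "even (e + v)" for v
  proof (cases "v = 0")
    case True
    then show ?thesis using hgt[of 0] that height_1[OF part] by simp
  next
    case False
    then show ?thesis using hgt[of v] mult[of v] that height_Suc_add_mult[of lam v] by auto
  qed
  have val: "row lam i = 0 \<or> row lam i \<in> set lam" for i
    using mem by auto
  show ?thesis
    unfolding special_seq_def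
  proof (intro conjI allI impI)
    fix i show "row lam (Suc i) \<le> row lam i"
      using partition_of_row_antimono[OF part] by simp
  next
    show "\<exists>n. row lam n = 0"
      by (rule exI[of _ "length lam"]) (simp add: row_def)
  next
    fix i assume i: "even (i + f)"
    have "odd (e + row lam i) \<and> odd (e + row lam (Suc i))" if ne: "row lam i \<noteq> row lam (Suc i)"
    proof -
      have lt: "row lam (Suc i) < row lam i"
        using ne partition_of_row_antimono[OF part, of i "Suc i"] by simp
      have cut: "v \<le> row lam j \<longleftrightarrow> j < Suc i" if "row lam (Suc i) < v" "v \<le> row lam i" for v j
        using that partition_of_row_antimono[OF part, of j i]
          partition_of_row_antimono[OF part, of "Suc i" j] by (cases "j \<le> i") auto
      have "height lam (row lam i) = Suc i" "height lam (Suc (row lam (Suc i))) = Suc i"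
        using lt by (auto intro!: height_eqI[OF part] cut)
      then show ?thesis
        using hgt[of "row lam i"] above[of "row lam (Suc i)"] val[of i] val[of "Suc i"] i by auto
    qed
    then show "row lam i = row lam (Suc i) \<or> odd (e + row lam i) \<and> odd (e + row lam (Suc i))"
      by blast
  next
    assume "odd f"
    show "odd (e + row lam 0)"
    proof
      assume "even (e + row lam 0)"
      with above[of "row lam 0"] val have "even (f + height lam (Suc (row lam 0)))"
        by blast
      moreover have "height lam (Suc (row lam 0)) = 0"
        using hiff[of "Suc (row lam 0)" 0] by simp
      ultimately show False using \<open>odd f\<close> by simp
    qed
  qed
qed

lemma special_partitionsI:
  assumes part: "partition_of N lam" and sp: "special_seq e f (row lam)"
  shows "lam \<in> special_partitions e f N"
proof -
  note hiff = less_height_iff[OF part]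
  have pair: "even (i + f) \<Longrightarrow> row lam i = row lam (Suc i) \<or>
      odd (e + row lam i) \<and> odd (e + row lam (Suc i))" for i
    using sp by (auto simp: special_seq_def)
  \<comment> \<open>for a bad value \<open>s\<close>, the block of rows equal to \<open>s\<close> neither starts nor ends inside a couple\<close>
  have above: "even (f + height lam (Suc s))" if s: "s = 0 \<or> s \<in> set lam" "even (e + s)" for s
  proof -
    define A where "A = height lam (Suc s)"
    obtain k where k: "row lam k = s"
      using s(1) by (metis in_set_conv_nth less_irrefl row_def)
    have "row lam A \<le> s"
      using hiff[of "Suc s" A] by (simp add: A_def not_le)
    moreover have "A \<le> k"
      using hiff[of "Suc s" k] k by (simp add: A_def)
    ultimately have A: "row lam A = s"
      using partition_of_row_antimono[OF part, of A k] k by simp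
    show ?thesis
    proof (rule ccontr)
      assume odd: "\<not> even (f + height lam (Suc s))"
      show False
      proof (cases A)
        case 0
        then show False using odd sp s A by (simp add: A_def special_seq_def)
      next
        case (Suc B)
        then have "s < row lam B"
          using hiff[of "Suc s" B] by (simp add: A_def)
        then show False
          using pair[of B] odd Suc s A by (auto simp: A_def)
      qed
    qed
  qed
  have at: "even (f + height lam s)" if s: "s \<in> set lam" "even (e + s)" for s
  proof -
    have pos: "0 < s" using s(1) part by (metis partition_of_def gr0I)
    obtain k where k: "row lam k = s"
      using s(1) by (metis in_set_conv_nth row_def)
    define B where "B = height lam s"
    have "k < B" using hiff[of s k] pos k by (simp add: B_def)
    then obtain C where C: "B = Suc C" by (cases B) auto
    have "row lam C = s"
      using hiff[of s C] pos k partition_of_row_antimono[OF part, of k C] \<open>k < B\<close> C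
      by (simp add: B_def)
    moreover have "row lam B < s"
      using hiff[of s B] pos by (simp add: B_def not_le)
    ultimately show ?thesis
      using pair[of C] s C by (auto simp: B_def)
  qed
  have "even (mult lam s)" if "s \<in> set lam" "even (e + s)" for s
    using above[of s] at[of s] that height_Suc_add_mult[of lam s] by auto
  moreover have "even (f + height lam 0)" if "even e"
    using above[of 0] that height_1[OF part] by simp
  ultimately show ?thesis
    using part at
    by (simp add: special_partitions_def eps_partitions_def cong_2_iff add.commute)
qed

lemma ex_partition_row:
  assumes dec: "\<And>i. g (Suc i) \<le> g i" and "g n = 0"
  shows "\<exists>lam N. partition_of N lam \<and> row lam = g"
proof -
  define m where "m = (LEAST n. g n = 0)"
  have m: "g m = 0" unfolding m_def by (rule LeastI) fact
  have pos: "0 < g i" if "i < m" for i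
    using not_less_Least[of i "\<lambda>n. g n = 0"] that by (auto simp: m_def)
  have anti: "g j \<le> g i" if "i \<le> j" for i j
    using that dec by (rule lift_Suc_antimono_le[rotated])
  have "row (map g [0..<m]) = g"
    using anti[of m] m by (auto simp: row_def fun_eq_iff not_less)
  moreover have "partition_of (sum_list (map g [0..<m])) (map g [0..<m])"
    using anti pos by (force simp: partition_of_def sorted_wrt_iff_nth_less)
  ultimately show ?thesis by blast
qed

section \<open>Local modifications of special sequences\<close>

lemma psum_cong: "(\<And>i. i < t \<Longrightarrow> g i = h i) \<Longrightarrow> psum g t = psum h t"
  by (simp add: psum_def)

lemma special_seq_antimono:
  assumes "special_seq e f g" "i \<le> j"
  shows "g j \<le> g i"
  using assms(2) by (rule lift_Suc_antimono_le[rotated]) (use assms(1) in \<open>simp add: special_seq_def\<close>)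

lemma special_seq_pair:
  assumes "special_seq e f g" "even (i + f)"
  shows "g i = g (Suc i) \<or> odd (e + g i) \<and> odd (e + g (Suc i))"
  using assms by (simp add: special_seq_def)

text \<open>Changing a good row to another good value keeps its couple legal provided that the partner is good;
  the last two assumptions say so for the two possible positions of the row in its couple.\<close>

lemma special_seq_upd:
  assumes g: "special_seq e f g"
    and v: "odd (e + v)" "g (Suc p) \<le> v" "p = 0 \<or> v \<le> g (p - 1)"
    and good: "odd (e + g p)"
  and next_good: "even (p + f) \<Longrightarrow> g p = g (Suc p) \<or> odd (e + g (Suc p))"
  and prev_good: "odd (p + f) \<Longrightarrow> p = 0 \<or> g (p - 1) = g p \<or> odd (e + g (p - 1))"
  shows "special_seq e f (g(p := v))"
  unfolding special_seq_def
proof (intro conjI allI impI)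
  fix i
  show "(g(p := v)) (Suc i) \<le> (g(p := v)) i"
    using special_seq_antimono[OF g, of i "Suc i"] v by auto
next
  obtain n where n: "g n = 0"
    using g by (auto simp: special_seq_def)
  have "(g(p := v)) (max n (Suc p)) = 0"
    using special_seq_antimono[OF g, of n "max n (Suc p)"] n by (auto simp: max_def)
  then show "\<exists>n. (g(p := v)) n = 0" by blast
next
  fix i assume i: "even (i + f)"
  show "(g(p := v)) i = (g(p := v)) (Suc i) \<or>
     odd (e + (g(p := v)) i) \<and> odd (e + (g(p := v)) (Suc i))"
  proof (cases "i = p \<or> Suc i = p")
    case True
    then show ?thesis
      using i v good next_good prev_good by auto
  next
    case False
    then show ?thesis using special_seq_pair[OF g i] by simp
  qed
next
  assume "odd f"
  then show "odd (e + (g(p := v)) 0)"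
    using g v by (simp add: special_seq_def)
qed

text \<open>A couple may be replaced by any couple of equal values that fits between its neighbours,
  whatever the parity of the value.\<close>

lemma special_seq_upd_pair:
  assumes g: "special_seq e f g" and p: "even (p + f)"
    and v: "g (Suc (Suc p)) \<le> v" "p = 0 \<or> v \<le> g (p - 1)"
  shows "special_seq e f (g(p := v, Suc p := v))"
  unfolding special_seq_def
proof (intro conjI allI impI)
  fix i
  show "(g(p := v, Suc p := v)) (Suc i) \<le> (g(p := v, Suc p := v)) i"
    using special_seq_antimono[OF g, of i "Suc i"] v by auto
next
  obtain n where n: "g n = 0"
    using g by (auto simp: special_seq_def)
  have "(g(p := v, Suc p := v)) (max n (Suc (Suc p))) = 0"
    using special_seq_antimono[OF g, of n "max n (Suc (Suc p))"] n by (auto simp: max_def)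
  then show "\<exists>n. (g(p := v, Suc p := v)) n = 0" by blast
next
  fix i assume i: "even (i + f)"
  have "Suc i \<noteq> p" "i \<noteq> Suc p"
    using i p by auto
  then show "(g(p := v, Suc p := v)) i = (g(p := v, Suc p := v)) (Suc i) \<or>
     odd (e + (g(p := v, Suc p := v)) i) \<and> odd (e + (g(p := v, Suc p := v)) (Suc i))"
    using special_seq_pair[OF g i] by auto
next
  assume "odd f"
  then have "p \<noteq> 0"
    using p by (cases p) auto
  then show "odd (e + (g(p := v, Suc p := v)) 0)"
    using g \<open>odd f\<close> by (simp add: special_seq_def)
qed

text \<open>The rows of a couple have an even sum, so the parity at the end of a couple is that of the
  initial single row, if there is one.\<close>

lemma psum_parity:
  assumes g: "special_seq e f g" and "even (t + f)"
  shows "even (psum g t + int (f * Suc e))"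
  using assms(2)
proof (induction t rule: less_induct)
  case (less t)
  consider "t = 0" | "t = Suc 0" | u where "t = Suc (Suc u)"
    by (metis not0_implies_Suc)
  then show ?case
  proof cases
    case 1
    then show ?thesis using less.prems by simp
  next
    case 2
    then have "odd f" using less.prems by simp
    then show ?thesis using g 2 by (simp add: special_seq_def)
  next
    case 3
    then have "even (u + f)" using less.prems by simp
    then show ?thesis
      using less.IH[of u] special_seq_pair[OF g, of u] 3 by auto
  qed
qed

section \<open>Gaps and forced moves in a minimal pair\<close>

text \<open>The rows \<open>g\<close> and \<open>h\<close> of a minimal degeneration, where \<open>l\<close> is the first row in which they differ.
  Equality of the sizes is stated through the partial sums far out.\<close>

locale minimal_pair =
  fixes e f l :: nat and g h :: "nat \<Rightarrow> nat"
  assumes special_g: "special_seq e f g" and special_h: "special_seq e f h"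
    and dominated: "psum h t \<le> psum g t"
    and same_size: "\<exists>T. \<forall>t\<ge>T. psum h t = psum g t"
    and common: "i < l \<Longrightarrow> h i = g i"
    and differ: "h l < g l"
    and minimal: "special_seq e f k \<Longrightarrow> (\<And>t. psum h t \<le> psum k t) \<Longrightarrow>
      (\<And>t. psum k t \<le> psum g t) \<Longrightarrow> k = h \<or> k = g"
begin

definition gap :: "nat \<Rightarrow> int" where
  "gap t = psum g t - psum h t"

lemma gap_Suc: "gap (Suc t) = gap t + int (g t) - int (h t)"
  by (simp add: gap_def)

lemma gap_nonneg: "0 \<le> gap t"
  using dominated by (simp add: gap_def)

lemma gap_start: "t \<le> l \<Longrightarrow> gap t = 0"
proof (induction t)
  case (Suc t)
  then show ?case using common[of t] by (simp add: gap_Suc)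
qed (simp add: gap_def)

lemma gap_even: "even (t + f) \<Longrightarrow> even (gap t)"
  using psum_parity[OF special_g, of t] psum_parity[OF special_h, of t]
  by (auto simp: gap_def)

lemmas g_le = special_seq_antimono[OF special_g]
lemmas h_le = special_seq_antimono[OF special_h]
lemmas g_pair = special_seq_pair[OF special_g]
lemmas h_pair = special_seq_pair[OF special_h]

lemma gap_ge_range:
  assumes "\<And>i. l \<le> i \<Longrightarrow> i < j \<Longrightarrow> h l \<le> g i" "l < t" "t \<le> j"
  shows "int (g l) - int (h l) \<le> gap t"
  using assms(3,2)
proof (induction t)
  case (Suc t)
  show ?case
  proof (cases "t = l")
    case True
    then show ?thesis using gap_start[of l] by (simp add: gap_Suc)
  next
    case False
    then show ?thesis
      using Suc assms(1)[of t] h_le[of l t] by (simp add: gap_Suc)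
  qed
qed simp

lemma gap_ge_growth:
  assumes "\<And>i. l \<le> i \<Longrightarrow> i < j \<Longrightarrow> h l < g i" "l \<le> t" "t \<le> j"
  shows "int t - int l \<le> gap t"
  using assms(3,2)
proof (induction t)
  case (Suc t)
  show ?case
  proof (cases "Suc t = l")
    case False
    then show ?thesis
      using Suc assms(1)[of t] h_le[of l t] by (simp add: gap_Suc)
  qed (use gap_nonneg in simp)
qed (use gap_nonneg in simp)

lemma first_below:
  assumes "h l \<le> c" "c \<le> g l"
  obtains j where "l < j" "g j < c" "\<And>i. l \<le> i \<Longrightarrow> i < j \<Longrightarrow> c \<le> g i"
proof -
  have "\<exists>i. l \<le> i \<and> g i < c"
  proof (rule ccontr)
    assume "\<not> ?thesis"
    then have ge: "c \<le> g i" if "l \<le> i" for i using that by (meson not_le)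
    obtain T where T: "\<And>t. T \<le> t \<Longrightarrow> psum h t = psum g t"
      using same_size by blast
    have "int (g l) - int (h l) \<le> gap (max T (Suc l))"
      by (rule gap_ge_range[of "max T (Suc l)"]) (use order_trans[OF assms(1) ge] in auto)
    then show False
      using T[of "max T (Suc l)"] differ by (simp add: gap_def)
  qed
  then obtain j where j: "l \<le> j \<and> g j < c" "\<And>i. i < j \<Longrightarrow> \<not> (l \<le> i \<and> g i < c)"
    using exists_least_iff[of "\<lambda>j. l \<le> j \<and> g j < c"] by blast
  show ?thesis
    using that[of j] j assms(2) by (metis le_neq_implies_less not_le)
qed

lemma squeeze:
  assumes "special_seq e f k" "\<And>t. psum h t \<le> psum k t" "\<And>t. psum k t \<le> psum g t" "k \<noteq> g"
  shows "h = k"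
  using minimal[OF assms(1-3)] assms(4) by simp

text \<open>If the gap closed in the middle of a bad couple of \<open>g\<close>, the couple of \<open>h\<close> would consist of
  different, hence good values, and the gap before it would be \<open>h j - g j\<close>, a difference of a good
  and a bad value. This is odd, but gaps at the ends of couples are even.\<close>

lemma mid_pair_pos:
  assumes j: "even (j + f)" and eq: "g (Suc j) = g j" and bad: "even (e + g j)" and "1 \<le> gap j"
  shows "1 \<le> gap (Suc j)"
proof (rule ccontr)
  assume "\<not> ?thesis"
  then have 0: "gap (Suc j) = 0" using gap_nonneg[of "Suc j"] by simp
  then have "h (Suc j) \<le> g j" "int (h j) = gap j + int (g j)"
    using gap_nonneg[of "Suc (Suc j)"] eq by (simp_all add: gap_Suc)
  moreover from this have "odd (e + h j)"
    using h_pair[OF j] assms(4) by auto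
  moreover have "even (h j) \<longleftrightarrow> even (g j)"
    using calculation(2) gap_even[OF j] by (metis even_add even_of_nat)
  ultimately show False
    using bad by simp
qed

text \<open>Two boxes have been removed from rows before \<open>j\<close>, where \<open>j\<close> is a step down from a good row.
  If \<open>g j\<close> is good, there is room for both boxes in row \<open>j\<close>; if it is bad, then \<open>j\<close> starts a couple,
  since a bad row in second position would have to equal the good row before it, and each row of the couple
  takes one box. By minimality the outcome is \<open>h\<close>.\<close>

lemma refill:
  assumes k: "special_seq e f k" and tail: "\<And>i. j \<le> i \<Longrightarrow> k i = g i"
    and deficit: "psum k j = psum g j - 2"
    and below: "\<And>t. t \<le> j \<Longrightarrow> psum h t \<le> psum k t" "\<And>t. t \<le> j \<Longrightarrow> psum k t \<le> psum g t"
    and j: "0 < j" and good: "odd (e + k (j - 1))" and step: "g j < k (j - 1)"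
  shows "odd (e + g j) \<and> g j + 2 \<le> k (j - 1) \<and> h = k(j := g j + 2) \<or>
    even (e + g j) \<and> even (j + f) \<and> g (Suc j) = g j \<and> h = k(j := g j + 1, Suc j := g j + 1)"
proof -
  have after: "psum k t = psum g t - 2" if "j \<le> t" for t
    using that
  proof (induction t rule: dec_induct)
    case base
    then show ?case by (rule deficit)
  next
    case (step t)
    then show ?case using tail[of t] by simp
  qed
  have gapj: "2 \<le> gap j"
    using below(1)[of j] deficit by (simp add: gap_def)
  have ne: "k' \<noteq> g" if "\<And>i. i < j \<Longrightarrow> k' i = k i" for k'
    using psum_cong[of j k' k] that deficit by auto
  show ?thesis
  proof (cases "odd (e + g j)")
    case True
    have two: "g j + 2 \<le> k (j - 1)"
      using True good step by presburger
    have "h = k(j := g j + 2)"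
    proof (rule squeeze)
      show "special_seq e f (k(j := g j + 2))"
        using k
      proof (rule special_seq_upd)
        show "k (Suc j) \<le> g j + 2"
          using tail[of "Suc j"] g_le[of j "Suc j"] by simp
        show "k j = k (Suc j) \<or> odd (e + k (Suc j))" if "even (j + f)"
          using tail[of j] tail[of "Suc j"] g_pair[OF that] True by auto
      qed (use True two good tail in auto)
      fix t
      show "psum h t \<le> psum (k(j := g j + 2)) t" "psum (k(j := g j + 2)) t \<le> psum g t"
        using below[of t] after[of t] dominated[of t] tail[of j] by (auto simp: psum_fun_upd)
    qed (simp add: ne)
    then show ?thesis using True two by blast
  next
    case False
    have jf: "even (j + f)"
    proof (rule ccontr)
      assume "odd (j + f)"
      then have "even (j - 1 + f)" using j by (cases j) auto
      then show False
        using special_seq_pair[OF k, of "j - 1"] j tail[of j] step False by auto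
    qed
    have eq: "g (Suc j) = g j" using g_pair[OF jf] False by auto
    have gap1: "1 \<le> gap (Suc j)"
      using mid_pair_pos[OF jf eq] False gapj by simp
    have "h = k(j := g j + 1, Suc j := g j + 1)"
    proof (rule squeeze)
      show "special_seq e f (k(j := g j + 1, Suc j := g j + 1))"
        using k jf
      proof (rule special_seq_upd_pair)
        show "k (Suc (Suc j)) \<le> g j + 1"
          using tail[of "Suc (Suc j)"] g_le[of j "Suc (Suc j)"] by simp
      qed (use step in simp)
      fix t
      consider "t \<le> j" | "t = Suc j" | "Suc j < t" by linarith
      then show "psum h t \<le> psum (k(j := g j + 1, Suc j := g j + 1)) t"
        "psum (k(j := g j + 1, Suc j := g j + 1)) t \<le> psum g t"
        using below[of t] after[of t] dominated[of t] tail[of j] tail[of "Suc j"] eq gap1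
        by (cases; simp add: psum_fun_upd gap_def)+
    qed (simp add: ne)
    then show ?thesis using False jf eq by blast
  qed
qed

lemma drop_one:
  assumes p: "p < j" "odd (e + g p)" "g (Suc p) + 2 \<le> g p"
    and gap: "\<And>t. p < t \<Longrightarrow> t \<le> j \<Longrightarrow> 2 \<le> gap t"
    and k: "k = g(p := g p - 2)"
    and j: "odd (e + k (j - 1))" "g j < k (j - 1)"
  shows "odd (e + g j) \<and> g j + 2 \<le> k (j - 1) \<and> h = k(j := g j + 2) \<or>
    even (e + g j) \<and> even (j + f) \<and> g (Suc j) = g j \<and> h = k(j := g j + 1, Suc j := g j + 1)"
proof -
  have "special_seq e f k"
    unfolding k using special_g
  proof (rule special_seq_upd)
    show "odd (e + (g p - 2))" using p by presburger
    show "p = 0 \<or> g p - 2 \<le> g (p - 1)"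
      using g_le[of "p - 1" p] by auto
    show "g p = g (Suc p) \<or> odd (e + g (Suc p))" if "even (p + f)"
      using g_pair[OF that] p by auto
    show "p = 0 \<or> g (p - 1) = g p \<or> odd (e + g (p - 1))" if "odd (p + f)"
      using g_pair[of "p - 1"] that by (cases p) auto
  qed (use p in auto)
  moreover have "psum k t = psum g t - (if p < t then 2 else 0)" for t
    using p unfolding k psum_fun_upd by auto
  moreover have "k i = g i" if "j \<le> i" for i
    using that p(1) by (simp add: k)
  moreover have "2 \<le> psum g t - psum h t" if "p < t" "t \<le> j" for t
    using gap[OF that] by (simp add: gap_def)
  then have "psum h t \<le> psum g t - (if p < t then 2 else 0)" if "t \<le> j" for t
    using dominated[of t] that by force
  ultimately show ?thesis
    using p(1) j by (intro refill) auto
qed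

lemma drop_pair:
  assumes p: "Suc p < j" "even (p + f)" "g (Suc p) = g p" "g (Suc (Suc p)) < g p"
    and gap1: "1 \<le> gap (Suc p)" and gap: "\<And>t. Suc p < t \<Longrightarrow> t \<le> j \<Longrightarrow> 2 \<le> gap t"
    and k: "k = g(p := g p - 1, Suc p := g p - 1)"
    and j: "odd (e + k (j - 1))" "g j < k (j - 1)"
  shows "odd (e + g j) \<and> g j + 2 \<le> k (j - 1) \<and> h = k(j := g j + 2) \<or>
    even (e + g j) \<and> even (j + f) \<and> g (Suc j) = g j \<and> h = k(j := g j + 1, Suc j := g j + 1)"
proof -
  have "special_seq e f k"
    unfolding k using special_g p(2)
  proof (rule special_seq_upd_pair)
    show "p = 0 \<or> g p - 1 \<le> g (p - 1)"
      using g_le[of "p - 1" p] by auto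
  qed (use p in auto)
  moreover have ps: "psum k t = psum g t - (if p < t then 1 else 0) - (if Suc p < t then 1 else 0)" for t
    using p unfolding k psum_fun_upd by auto
  moreover have "psum h t \<le> psum k t" if "t \<le> j" for t
  proof -
    consider "t \<le> p" | "t = Suc p" | "Suc p < t" by linarith
    then show ?thesis
      using gap1 gap[of t] dominated[of t] that by cases (simp_all add: ps gap_def del: psum_Suc)
  qed
  moreover have "k i = g i" if "j \<le> i" for i
    using that p(1) by (simp add: k)
  ultimately show ?thesis
    using p(1) j by (intro refill) auto
qed

text \<open>A couple \<open>(x + 2, x)\<close> may be evened out to \<open>(x + 1, x + 1)\<close>. The gap in the middle of the couple
  has to be positive for this.\<close>

lemma level:
  assumes p: "even (p + f)" "g p = g (Suc p) + 2" and gap1: "1 \<le> gap (Suc p)"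
  shows "h = g(p := g p - 1, Suc p := g p - 1)"
proof (rule squeeze)
  show "special_seq e f (g(p := g p - 1, Suc p := g p - 1))"
    using special_g p(1)
  proof (rule special_seq_upd_pair)
    show "g (Suc (Suc p)) \<le> g p - 1"
      using g_le[of "Suc p" "Suc (Suc p)"] p by simp
    show "p = 0 \<or> g p - 1 \<le> g (p - 1)"
      using g_le[of "p - 1" p] by auto
  qed
  fix t
  consider "t \<le> p" | "t = Suc p" | "Suc p < t" by linarith
  then show "psum h t \<le> psum (g(p := g p - 1, Suc p := g p - 1)) t"
      "psum (g(p := g p - 1, Suc p := g p - 1)) t \<le> psum g t"
    using dominated[of t] gap1 p by (cases; simp add: psum_fun_upd gap_def)+
next
  show "g(p := g p - 1, Suc p := g p - 1) \<noteq> g"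
    using p by (auto simp: fun_eq_iff)
qed

text \<open>The next three facts are the obstructions used in the case analysis: \<open>h\<close> and \<open>g\<close> differ in row
  \<open>l\<close>, so \<open>h\<close> cannot arise from \<open>g\<close> by a move that starts below it.\<close>

lemma no_drop_one:
  assumes "l < p" "p < j" "odd (e + g p)" "g (Suc p) + 2 \<le> g p"
    and "\<And>t. p < t \<Longrightarrow> t \<le> j \<Longrightarrow> 2 \<le> gap t"
    and "odd (e + (g(p := g p - 2)) (j - 1))" "g j < (g(p := g p - 2)) (j - 1)"
  shows False
  using drop_one[OF assms(2-5) refl assms(6-7)] assms(1,2) differ by auto

lemma no_drop_pair:
  assumes "l < p" "Suc p < j" "even (p + f)" "g (Suc p) = g p" "g (Suc (Suc p)) < g p"
    "1 \<le> gap (Suc p)" and "\<And>t. Suc p < t \<Longrightarrow> t \<le> j \<Longrightarrow> 2 \<le> gap t"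
    and "odd (e + (g(p := g p - 1, Suc p := g p - 1)) (j - 1))"
      "g j < (g(p := g p - 1, Suc p := g p - 1)) (j - 1)"
  shows False
  using drop_pair[OF assms(2-7) refl assms(8-9)] assms(1,2) differ by auto

lemma no_level:
  assumes "l < p" "even (p + f)" "g p = g (Suc p) + 2" "1 \<le> gap (Suc p)"
  shows False
  using level[OF assms(2-4)] assms(1) differ by auto

end

section \<open>The ten entries of the list\<close>

text \<open>Up to constants, minus twice the dimension of the orbit: the first summand adds up to
  \<open>\<Sum>j. h(j)\<^sup>2\<close>, and the second one counts bad rows. Counting odd rows positively for \<open>e = 1\<close> and
  negatively for \<open>e = 0\<close> amounts to this, up to the number of rows.\<close>

definition weight :: "nat \<Rightarrow> nat \<Rightarrow> (nat \<Rightarrow> nat) \<Rightarrow> int" where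
  "weight e n g = (\<Sum>i<n. int (2 * i + 1) * int (g i) + of_bool (even (e + g i)))"

lemma weight_upd:
  "p < n \<Longrightarrow> weight e n (g(p := v)) =
     weight e n g + int (2 * p + 1) * (int v - int (g p)) +
     of_bool (even (e + v)) - of_bool (even (e + g p))"
proof (induction n)
  case (Suc n)
  show ?case
  proof (cases "p = n")
    case True
    then have "weight e n (g(p := v)) = weight e n g"
      by (simp add: weight_def)
    then show ?thesis
      using True by (simp add: weight_def algebra_simps)
  next
    case False
    then show ?thesis using Suc by (simp add: weight_def)
  qed
qed simp

text \<open>Cancelling \<open>l\<close> rows and \<open>s\<close> columns leaves \<open>xs\<close> and \<open>ys\<close>. The condition \<open>length xs < length ys\<close>
  ensures that column \<open>s + 1\<close> is not common to both diagrams.\<close>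

definition reduces_to ::
  "nat \<Rightarrow> nat \<Rightarrow> (nat \<Rightarrow> nat) \<Rightarrow> (nat \<Rightarrow> nat) \<Rightarrow> nat list \<Rightarrow> nat list \<Rightarrow> bool" where
  "reduces_to l s g h xs ys \<longleftrightarrow> length xs < length ys \<and> 0 \<notin> set xs \<and> 0 \<notin> set ys \<and>
     (\<forall>i<length ys. g (l + i) = s + row xs i \<and> h (l + i) = s + ys ! i) \<and>
     (\<forall>i\<ge>l + length ys. h i = g i)"

text \<open>The thresholds for the weight are twice the codimensions 2 and 4.\<close>

definition classified :: "nat \<Rightarrow> nat \<Rightarrow> nat \<Rightarrow> (nat \<Rightarrow> nat) \<Rightarrow> (nat \<Rightarrow> nat) \<Rightarrow> bool" where
  "classified e f l g h \<longleftrightarrow> (\<exists>t s xs ys. is_entry t e f l s xs ys \<and> reduces_to l s g h xs ys \<and>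
     (\<forall>n\<ge>l + length ys. if codim_two_type t then weight e n h - weight e n g = 4
        else 8 \<le> weight e n h - weight e n g))"

text \<open>The lemmas \<open>classified_a\<close> to \<open>classified_g_sp\<close> translate the ten local pictures that arise in the
  case analysis into the entries of the list. In all of them \<open>s\<close> is the value of the row that
  receives the boxes.\<close>

lemma classified_a:
  assumes "even (l + f)" "odd (e + s)" "g l = s + 2" "g (Suc l) = s"
    and "h = g(l := s + 1, Suc l := s + 1)"
  shows "classified e f l g h"
  unfolding classified_def
proof (intro exI conjI)
  show "is_entry Type_a e f l s [2] [1, 1]"
    using assms by (simp add: cong_2_iff)
  show "reduces_to l s g h [2] [1, 1]"
    using assms by (auto simp: reduces_to_def row_def less_Suc_eq)
  show "\<forall>k\<ge>l + length [1::nat, 1]. if codim_two_type Type_a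
    then weight e k h - weight e k g = 4 else 8 \<le> weight e k h - weight e k g"
    using assms by (auto simp: weight_upd algebra_simps)
qed

lemma classified_b:
  assumes "odd (e + s)" "n \<ge> 2" "g l = s + 2 * n" "g (Suc l) = s"
    and "h = g(l := s + (2 * n - 2), Suc l := s + 2)"
  shows "classified e f l g h"
  unfolding classified_def
proof (intro exI conjI)
  obtain m where n: "n = m + 2"
    using assms(2) by (metis add.commute le_Suc_ex)
  show "is_entry (Type_b n) e f l s [2 * n] [2 * n - 2, 2]"
    using assms by (simp add: cong_2_iff)
  show "reduces_to l s g h [2 * n] [2 * n - 2, 2]"
    using assms by (auto simp: reduces_to_def row_def less_Suc_eq)
  show "\<forall>k\<ge>l + length [2 * n - 2, 2]. if codim_two_type (Type_b n)
    then weight e k h - weight e k g = 4 else 8 \<le> weight e k h - weight e k g"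
    using assms n by (auto simp: weight_upd algebra_simps)
qed

lemma classified_c:
  assumes "odd (l + f)" "even (e + s)" "n \<ge> 1" "g l = s + (2 * n + 1)" "g (Suc l) = s"
    "g (Suc (Suc l)) = s"
    and "h = g(l := s + (2 * n - 1), Suc l := s + 1, Suc (Suc l) := s + 1)"
  shows "classified e f l g h"
  unfolding classified_def
proof (intro exI conjI)
  obtain m where n: "n = Suc m"
    using assms(3) by (cases n) auto
  show "is_entry (Type_c n) e f l s [2 * n + 1] [2 * n - 1, 1, 1]"
    using assms by (simp add: cong_2_iff add.commute)
  show "reduces_to l s g h [2 * n + 1] [2 * n - 1, 1, 1]"
    using assms by (auto simp: reduces_to_def row_def less_Suc_eq)
  show "\<forall>k\<ge>l + length [2 * n - 1, 1, 1]. if codim_two_type (Type_c n)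
    then weight e k h - weight e k g = 4 else 8 \<le> weight e k h - weight e k g"
    using assms n by (auto simp: weight_upd algebra_simps)
qed

lemma classified_d:
  assumes "even (l + f)" "odd (e + s)" "n \<ge> 1" "g l = s + (2 * n + 1)"
    "g (Suc l) = s + (2 * n + 1)" "g (l + 2) = s"
    and "h = g(l := s + 2 * n, Suc l := s + 2 * n, l + 2 := s + 2)"
  shows "classified e f l g h"
  unfolding classified_def
proof (intro exI conjI)
  show "is_entry (Type_d n) e f l s [2 * n + 1, 2 * n + 1] [2 * n, 2 * n, 2]"
    using assms by (simp add: cong_2_iff)
  show "reduces_to l s g h [2 * n + 1, 2 * n + 1] [2 * n, 2 * n, 2]"
    using assms by (auto simp: reduces_to_def row_def less_Suc_eq)
  show "\<forall>k\<ge>l + length [2 * n, 2 * n, 2]. if codim_two_type (Type_d n)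
    then weight e k h - weight e k g = 4 else 8 \<le> weight e k h - weight e k g"
    using assms by (auto simp: weight_upd algebra_simps)
qed

lemma classified_e:
  assumes "even (l + f)" "even (e + s)" "n \<ge> 1" "g l = s + 2 * n"
    "g (Suc l) = s + 2 * n" "g (l + 2) = s" "g (Suc (l + 2)) = s"
    and "h = g(l := s + (2 * n - 1), Suc l := s + (2 * n - 1), l + 2 := s + 1, Suc (l + 2) := s + 1)"
  shows "classified e f l g h"
  unfolding classified_def
proof (intro exI conjI)
  obtain m where n: "n = Suc m"
    using assms(3) by (cases n) auto
  show "is_entry (Type_e n) e f l s [2 * n, 2 * n] [2 * n - 1, 2 * n - 1, 1, 1]"
    using assms by (simp add: cong_2_iff add.commute)
  show "reduces_to l s g h [2 * n, 2 * n] [2 * n - 1, 2 * n - 1, 1, 1]"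
    using assms by (auto simp: reduces_to_def row_def less_Suc_eq)
  show "\<forall>k\<ge>l + length [2 * n - 1, 2 * n - 1, 1, 1]. if codim_two_type (Type_e n)
    then weight e k h - weight e k g = 4 else 8 \<le> weight e k h - weight e k g"
    using assms n by (auto simp: weight_upd algebra_simps)
qed

lemma replicate_2: "replicate 2 x = [x, x]"
  by (simp add: numeral_2_eq_2)

text \<open>Common shape of the entries of codimension at least four: \<open>a\<close> rows drop to the height of a run
  of \<open>q\<close> rows below them, and the following \<open>b\<close> rows rise to it.\<close>

lemma reduces_to_run:
  assumes v: "\<And>i. l \<le> i \<Longrightarrow> i < l + a \<Longrightarrow> g i = s + v"
    and u: "\<And>i. l + a \<le> i \<Longrightarrow> i < l + a + q \<Longrightarrow> g i = s + u"
    and s: "\<And>i. l + a + q \<le> i \<Longrightarrow> i < l + a + q + b \<Longrightarrow> g i = s"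
    and h: "\<And>i. l \<le> i \<Longrightarrow> i < l + a + q + b \<Longrightarrow> h i = s + u"
    and rest: "\<And>i. l + a + q + b \<le> i \<Longrightarrow> h i = g i"
    and pos: "0 < u" "0 < v" "0 < b"
  shows "reduces_to l s g h (replicate a v @ replicate q u) (replicate (a + q + b) u)"
  unfolding reduces_to_def
proof (intro conjI allI impI)
  fix i assume i: "i < length (replicate (a + q + b) u)"
  have "row (replicate a v @ replicate q u) i = (if i < a then v else if i < a + q then u else 0)"
    by (auto simp: row_def nth_append)
  then show "g (l + i) = s + row (replicate a v @ replicate q u) i"
    using v[of "l + i"] u[of "l + i"] s[of "l + i"] i by simp
  show "h (l + i) = s + replicate (a + q + b) u ! i"
    using h[of "l + i"] i by simp
next
  fix i assume "l + length (replicate (a + q + b) u) \<le> i"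
  then show "h i = g i"
    using rest[of i] by simp
qed (use pos in auto)

lemma classified_h_sp:
  assumes par: "odd (l + f)" "odd (e + s)" "even q" "0 < q" "j = Suc l + q"
    and lead: "g l = s + 4"
    and run: "\<And>i. l < i \<Longrightarrow> i < j \<Longrightarrow> g i = s + 2"
    and tail: "g j = s"
    and h: "h = g(l := s + 2, j := s + 2)"
  shows "classified e f l g h"
  unfolding classified_def
proof (intro exI conjI)
  define n where "n = q div 2 + 1"
  have q: "q = 2 * n - 2" "1 + q + 1 = 2 * n" "n \<ge> 2"
    using par unfolding n_def by presburger+
  show "is_entry (Type_h_sp n) e f l s (replicate 1 4 @ replicate q 2) (replicate (1 + q + 1) 2)"
    using par(1-2) q by (simp add: cong_2_iff add.commute replicate_2)
  show "reduces_to l s g h (replicate 1 4 @ replicate q 2) (replicate (1 + q + 1) 2)"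
  proof (rule reduces_to_run)
    show "g i = s + 4" if "l \<le> i" "i < l + 1" for i
    proof -
      have "i = l" using that by linarith
      then show ?thesis using lead by auto
    qed
    show "g i = s + 2" if "l + 1 \<le> i" "i < l + 1 + q" for i
      using that run[of i] par(5) by simp
    show "g i = s" if "l + 1 + q \<le> i" "i < l + 1 + q + 1" for i
    proof -
      have "i = j" using that par(5) by linarith
      then show ?thesis using tail by auto
    qed
    show "h i = s + 2" if "l \<le> i" "i < l + 1 + q + 1" for i
    proof -
      have "i = l \<or> l < i \<and> i < j \<or> i = j"
        using that par(5) by linarith
      then show ?thesis
        using run[of i] by (auto simp: h)
    qed
    show "h i = g i" if "l + 1 + q + 1 \<le> i" for i
      using that par(5) by (simp add: h)
  qed simp_all
  have "weight e k h - weight e k g \<ge> 8" if "k > j" for k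
    using that par lead tail by (simp add: h weight_upd algebra_simps)
  then show "\<forall>k\<ge>l + length (replicate (1 + q + 1) (2::nat)). if codim_two_type (Type_h_sp n)
    then weight e k h - weight e k g = 4 else 8 \<le> weight e k h - weight e k g"
    using par(5) by simp
qed

lemma classified_f1_sp:
  assumes par: "odd (l + f)" "even (e + s)" "even q" "0 < q" "j = Suc l + q"
    and lead: "g l = s + 3"
    and run: "\<And>i. l < i \<Longrightarrow> i < j \<Longrightarrow> g i = s + 1"
    and tail: "g j = s" "g (Suc j) = s"
    and h: "h = g(l := s + 1, j := s + 1, Suc j := s + 1)"
  shows "classified e f l g h"
  unfolding classified_def
proof (intro exI conjI)
  define n where "n = q div 2 + 1"
  have q: "q = 2 * n - 2" "1 + q + 2 = 2 * n + 1" "n \<ge> 2"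
    using par unfolding n_def by presburger+
  show "is_entry (Type_f1_sp n) e f l s (replicate 1 3 @ replicate q 1) (replicate (1 + q + 2) 1)"
    using par(1-2) q by (simp add: cong_2_iff add.commute replicate_2)
  show "reduces_to l s g h (replicate 1 3 @ replicate q 1) (replicate (1 + q + 2) 1)"
  proof (rule reduces_to_run)
    show "g i = s + 3" if "l \<le> i" "i < l + 1" for i
    proof -
      have "i = l" using that by linarith
      then show ?thesis using lead by auto
    qed
    show "g i = s + 1" if "l + 1 \<le> i" "i < l + 1 + q" for i
      using that run[of i] par(5) by simp
    show "g i = s" if "l + 1 + q \<le> i" "i < l + 1 + q + 2" for i
    proof -
      have "i = j \<or> i = Suc j" using that par(5) by linarith
      then show ?thesis using tail by auto
    qed
    show "h i = s + 1" if "l \<le> i" "i < l + 1 + q + 2" for i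
    proof -
      have "i = l \<or> l < i \<and> i < j \<or> i = j \<or> i = Suc j"
        using that par(5) by linarith
      then show ?thesis
        using run[of i] by (auto simp: h)
    qed
    show "h i = g i" if "l + 1 + q + 2 \<le> i" for i
      using that par(5) by (simp add: h)
  qed simp_all
  have "weight e k h - weight e k g \<ge> 8" if "k > Suc j" for k
    using that par lead tail by (simp add: h weight_upd algebra_simps)
  then show "\<forall>k\<ge>l + length (replicate (1 + q + 2) (1::nat)). if codim_two_type (Type_f1_sp n)
    then weight e k h - weight e k g = 4 else 8 \<le> weight e k h - weight e k g"
    using par(5) by simp
qed

lemma classified_f2_sp:
  assumes par: "even (l + f)" "odd (e + s)" "even q" "0 < q" "j = l + 2 + q"
    and lead: "g l = s + 3" "g (Suc l) = s + 3"
    and run: "\<And>i. Suc l < i \<Longrightarrow> i < j \<Longrightarrow> g i = s + 2"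
    and tail: "g j = s"
    and h: "h = g(l := s + 2, Suc l := s + 2, j := s + 2)"
  shows "classified e f l g h"
  unfolding classified_def
proof (intro exI conjI)
  define n where "n = q div 2 + 1"
  have q: "q = 2 * n - 2" "2 + q + 1 = 2 * n + 1" "n \<ge> 2"
    using par unfolding n_def by presburger+
  show "is_entry (Type_f2_sp n) e f l s (replicate 2 3 @ replicate q 2) (replicate (2 + q + 1) 2)"
    using par(1-2) q by (simp add: cong_2_iff add.commute replicate_2)
  show "reduces_to l s g h (replicate 2 3 @ replicate q 2) (replicate (2 + q + 1) 2)"
  proof (rule reduces_to_run)
    show "g i = s + 3" if "l \<le> i" "i < l + 2" for i
    proof -
      have "i = l \<or> i = Suc l" using that by linarith
      then show ?thesis using lead by auto
    qed
    show "g i = s + 2" if "l + 2 \<le> i" "i < l + 2 + q" for i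
      using that run[of i] par(5) by simp
    show "g i = s" if "l + 2 + q \<le> i" "i < l + 2 + q + 1" for i
    proof -
      have "i = j" using that par(5) by linarith
      then show ?thesis using tail by auto
    qed
    show "h i = s + 2" if "l \<le> i" "i < l + 2 + q + 1" for i
    proof -
      have "i = l \<or> i = Suc l \<or> Suc l < i \<and> i < j \<or> i = j"
        using that par(5) by linarith
      then show ?thesis
        using run[of i] by (auto simp: h)
    qed
    show "h i = g i" if "l + 2 + q + 1 \<le> i" for i
      using that par(5) by (simp add: h)
  qed simp_all
  have "weight e k h - weight e k g \<ge> 8" if "k > j" for k
    using that par lead tail by (simp add: h weight_upd algebra_simps)
  then show "\<forall>k\<ge>l + length (replicate (2 + q + 1) (2::nat)). if codim_two_type (Type_f2_sp n)
    then weight e k h - weight e k g = 4 else 8 \<le> weight e k h - weight e k g"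
    using par(5) by simp
qed

lemma classified_h:
  assumes par: "even (l + f)" "even (e + s)" "even q" "0 < q" "j = l + 2 + q"
    and lead: "g l = s + 2" "g (Suc l) = s + 2"
    and run: "\<And>i. Suc l < i \<Longrightarrow> i < j \<Longrightarrow> g i = s + 1"
    and tail: "g j = s" "g (Suc j) = s"
    and h: "h = g(l := s + 1, Suc l := s + 1, j := s + 1, Suc j := s + 1)"
  shows "classified e f l g h"
  unfolding classified_def
proof (intro exI conjI)
  define n where "n = q div 2 + 2"
  have q: "q = 2 * n - 4" "2 + q + 2 = 2 * n" "n \<ge> 3"
    using par unfolding n_def by presburger+
  show "is_entry (Type_h n) e f l s (replicate 2 2 @ replicate q 1) (replicate (2 + q + 2) 1)"
    using par(1-2) q by (simp add: cong_2_iff add.commute replicate_2)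
  show "reduces_to l s g h (replicate 2 2 @ replicate q 1) (replicate (2 + q + 2) 1)"
  proof (rule reduces_to_run)
    show "g i = s + 2" if "l \<le> i" "i < l + 2" for i
    proof -
      have "i = l \<or> i = Suc l" using that by linarith
      then show ?thesis using lead by auto
    qed
    show "g i = s + 1" if "l + 2 \<le> i" "i < l + 2 + q" for i
      using that run[of i] par(5) by simp
    show "g i = s" if "l + 2 + q \<le> i" "i < l + 2 + q + 2" for i
    proof -
      have "i = j \<or> i = Suc j" using that par(5) by linarith
      then show ?thesis using tail by auto
    qed
    show "h i = s + 1" if "l \<le> i" "i < l + 2 + q + 2" for i
    proof -
      have "i = l \<or> i = Suc l \<or> Suc l < i \<and> i < j \<or> i = j \<or> i = Suc j"
        using that par(5) by linarith
      then show ?thesis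
        using run[of i] by (auto simp: h)
    qed
    show "h i = g i" if "l + 2 + q + 2 \<le> i" for i
      using that par(5) by (simp add: h)
  qed simp_all
  have "weight e k h - weight e k g \<ge> 8" if "k > Suc j" for k
    using that par lead tail by (simp add: h weight_upd algebra_simps)
  then show "\<forall>k\<ge>l + length (replicate (2 + q + 2) (1::nat)). if codim_two_type (Type_h n)
    then weight e k h - weight e k g = 4 else 8 \<le> weight e k h - weight e k g"
    using par(5) by simp
qed

lemma classified_g_sp:
  assumes par: "even (l + f)" "odd (e + s)" "even q" "j = l + 2 + q"
    and lead: "g l = s + 2" "g (Suc l) = s + 2"
    and run: "\<And>i. Suc l < i \<Longrightarrow> i < j \<Longrightarrow> g i = s + 1"
    and tail: "g j = s" "g (Suc j) = s"
    and h: "h = g(l := s + 1, Suc l := s + 1, j := s + 1, Suc j := s + 1)"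
  shows "classified e f l g h"
  unfolding classified_def
proof (intro exI conjI)
  define n where "n = q div 2 + 2"
  have q: "q = 2 * n - 4" "2 + q + 2 = 2 * n" "n \<ge> 2"
    using par unfolding n_def by presburger+
  show "is_entry (Type_g_sp n) e f l s (replicate 2 2 @ replicate q 1) (replicate (2 + q + 2) 1)"
    using par(1-2) q by (simp add: cong_2_iff add.commute replicate_2)
  show "reduces_to l s g h (replicate 2 2 @ replicate q 1) (replicate (2 + q + 2) 1)"
  proof (rule reduces_to_run)
    show "g i = s + 2" if "l \<le> i" "i < l + 2" for i
    proof -
      have "i = l \<or> i = Suc l" using that by linarith
      then show ?thesis using lead by auto
    qed
    show "g i = s + 1" if "l + 2 \<le> i" "i < l + 2 + q" for i
      using that run[of i] par(4) by simp
    show "g i = s" if "l + 2 + q \<le> i" "i < l + 2 + q + 2" for i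
    proof -
      have "i = j \<or> i = Suc j" using that par(4) by linarith
      then show ?thesis using tail by auto
    qed
    show "h i = s + 1" if "l \<le> i" "i < l + 2 + q + 2" for i
    proof -
      have "i = l \<or> i = Suc l \<or> Suc l < i \<and> i < j \<or> i = j \<or> i = Suc j"
        using that par(4) by linarith
      then show ?thesis
        using run[of i] by (auto simp: h)
    qed
    show "h i = g i" if "l + 2 + q + 2 \<le> i" for i
      using that par(4) by (simp add: h)
  qed simp_all
  have "weight e k h - weight e k g \<ge> 8" if "k > Suc j" for k
    using that par lead tail by (simp add: h weight_upd algebra_simps)
  then show "\<forall>k\<ge>l + length (replicate (2 + q + 2) (1::nat)). if codim_two_type (Type_g_sp n)
    then weight e k h - weight e k g = 4 else 8 \<le> weight e k h - weight e k g"
    using par(4) by simp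
qed

section \<open>Case analysis on the first differing row\<close>

context minimal_pair
begin

text \<open>As long as \<open>g\<close> stays above \<open>h l\<close>, the largest row of \<open>h\<close> from \<open>l\<close> on, the gap does not shrink.\<close>

lemma gap_mono_range:
  assumes "l \<le> u" "u \<le> t" "\<And>i. u \<le> i \<Longrightarrow> i < t \<Longrightarrow> h l \<le> g i"
  shows "gap u \<le> gap t"
  using assms(2,3)
proof (induction t rule: dec_induct)
  case (step t)
  then have "gap u \<le> gap t" "h l \<le> g t" by auto
  moreover have "h t \<le> h l" using h_le[of l t] step(1) assms(1) by simp
  ultimately show ?case by (simp add: gap_Suc)
qed simp

text \<open>If row \<open>l\<close> is second in its couple, then \<open>h\<close> has different rows in this couple, which are therefore
  good, and the first of them is shared with \<open>g\<close>.\<close>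

lemma unpaired_good:
  assumes "odd (l + f)"
  shows "odd (e + g l)" "odd (e + h l)"
proof -
  have "odd (e + g l) \<and> odd (e + h l)"
  proof (cases l)
    case 0
    then show ?thesis using assms special_g special_h by (simp add: special_seq_def)
  next
    case (Suc i)
    then have i: "even (i + f)" using assms by simp
    have "h i = g i" using common Suc by simp
    moreover have "h l < h i" using differ g_le[of i l] Suc \<open>h i = g i\<close> by simp
    ultimately have "odd (e + h i) \<and> odd (e + h l)"
      using h_pair[OF i] unfolding Suc[symmetric] by (metis less_irrefl)
    then show ?thesis
      using g_pair[OF i] \<open>h i = g i\<close> unfolding Suc[symmetric] by metis
  qed
  then show "odd (e + g l)" "odd (e + h l)" by blast+
qed

text \<open>The plateau at row \<open>l\<close> ends, since otherwise \<open>g\<close> would have more boxes than \<open>h\<close>.\<close>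

lemma plateau:
  obtains P where "l < P" "g P < g l" "\<And>i. l \<le> i \<Longrightarrow> i < P \<Longrightarrow> g i = g l"
proof -
  obtain P where P: "l < P" "g P < g l" "\<And>i. l \<le> i \<Longrightarrow> i < P \<Longrightarrow> g l \<le> g i"
    using first_below[of "g l"] differ by auto
  show ?thesis
    using P g_le[of l] by (intro that[of P]) (auto intro: le_antisym)
qed

text \<open>A good row strictly below row \<open>l\<close> cannot be followed by a step that leaves room for a move. A step by
  more than two allows two boxes to move down into the next row or couple; a step by exactly two inside a couple can be
  levelled.\<close>

lemma inner_step:
  assumes "l < p" "odd (e + g p)" "g (Suc p) < g p" "2 \<le> gap (Suc p)"
  shows "g p \<le> g (Suc p) + 2" "odd (e + g (Suc p)) \<Longrightarrow> odd (p + f)"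
proof -
  show le: "g p \<le> g (Suc p) + 2"
  proof (rule ccontr)
    assume "\<not> ?thesis"
    then show False
      using assms by (intro no_drop_one[of p "Suc p"]) (auto simp: le_Suc_eq)
  qed
  show "odd (p + f)" if "odd (e + g (Suc p))"
  proof
    assume "even (p + f)"
    moreover have "g p = g (Suc p) + 2"
      using le assms(2,3) that by presburger
    ultimately show False
      using assms by (intro no_level[of p]) auto
  qed
qed

text \<open>Both \<open>a = g l\<close> and \<open>h l\<close> are good, so \<open>h l \<le> a - 2\<close>, and the gap is at least two down to the first
  row \<open>j\<close> of length less than \<open>a - 2\<close>. Rows of the bad value \<open>a - 1\<close> would form couples, the last of which could give
  two boxes to row \<open>j\<close> without touching row \<open>l\<close>. So the plateau drops to at most \<open>a - 2\<close>, and its last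
  row can give two boxes; it must therefore be row \<open>l\<close> itself. If rows of value \<open>a - 2\<close> come in
  between, \<open>inner_step\<close> bounds the step at \<open>j\<close>. The outcomes are types \<open>b\<close> and \<open>c\<close> without and
  \<open>h_sp\<close> and \<open>f1_sp\<close> with such rows.\<close>

lemma classified_unpaired:
  assumes lf: "odd (l + f)"
  shows "classified e f l g h"
proof -
  define a where "a = g l"
  have a: "odd (e + a)" and hl: "h l + 2 \<le> a"
    using unpaired_good[OF lf] differ unfolding a_def by presburger+
  obtain j where j: "l < j" "g j < a - 2" "\<And>i. l \<le> i \<Longrightarrow> i < j \<Longrightarrow> a - 2 \<le> g i"
    by (rule first_below[of "a - 2"]) (use hl in \<open>auto simp: a_def\<close>)
  obtain P where P: "l < P" "g P < a" "\<And>i. l \<le> i \<Longrightarrow> i < P \<Longrightarrow> g i = a"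
    unfolding a_def by (rule plateau, blast)
  have "P \<le> j"
    using P(3)[of j] j by (cases "P \<le> j") auto
  have gap2: "2 \<le> gap t" if "l < t" "t \<le> j" for t
    using gap_ge_range[of j t] j(3) that hl by (force simp: a_def)
  \<comment> \<open>\<open>Q\<close> is the row after the last \<open>a - 1\<close>, so that \<open>(Q - 2, Q - 1)\<close> is the couple that could move\<close>
  have "g P \<noteq> a - 1"
  proof
    assume gP: "g P = a - 1"
    obtain Q where Q: "l < Q" "g Q < a - 1" "\<And>i. l \<le> i \<Longrightarrow> i < Q \<Longrightarrow> a - 1 \<le> g i"
      by (rule first_below[of "a - 1"]) (use hl in \<open>auto simp: a_def\<close>)
    have "P < Q"
      using P(3)[of Q] Q(1,2) gP by (cases Q P rule: linorder_cases) auto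
    then obtain p where p: "Q = Suc (Suc p)" "P \<le> Suc p"
      using P(1) by (metis Suc_lessE less_Suc_eq_le less_nat_zero_code not0_implies_Suc)
    have gp: "g (Suc p) = a - 1"
      using Q(3)[of "Suc p"] g_le[OF p(2)] P(1) p gP by simp
    have bad: "even (e + (a - 1))"
      using a hl by presburger
    have "odd (Suc p + f)"
      using g_pair[of "Suc p"] gp bad Q(2) p(1) by auto
    then have pf: "even (p + f)" by simp
    then have eq: "g (Suc p) = g p"
      using g_pair[of p] gp bad by auto
    have "l < p"
    proof -
      have "p \<noteq> l" using eq gp hl by (auto simp: a_def)
      then show ?thesis using P(1) p(2) by simp
    qed
    have "Q \<le> j"
      using Q(3)[of j] j by (cases "Q \<le> j") auto
    have last: "(g(p := g p - 1, Suc p := g p - 1)) (j - 1) = a - 2"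
    proof (cases "j = Q")
      case True
      then show ?thesis using eq gp p(1) by simp
    next
      case False
      then have "Q \<le> j - 1" "j - 1 < j" using \<open>Q \<le> j\<close> Q(1) by auto
      then show ?thesis
        using j(3)[of "j - 1"] g_le[of Q "j - 1"] Q(1,2) p(1) by simp
    qed
    show False
    proof (rule no_drop_pair[OF \<open>l < p\<close> _ pf eq])
      show "odd (e + (g(p := g p - 1, Suc p := g p - 1)) (j - 1))"
        unfolding last using a hl by presburger
      show "g j < (g(p := g p - 1, Suc p := g p - 1)) (j - 1)"
        unfolding last by (rule j(2))
      show "1 \<le> gap (Suc p)" using gap2[of "Suc p"] \<open>l < p\<close> \<open>Q \<le> j\<close> p(1) by simp
    qed (use \<open>l < p\<close> \<open>Q \<le> j\<close> p(1) Q(2) eq gp gap2 in auto)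
  qed
  then have gP: "g P + 2 \<le> a" using P(2) by simp
  obtain p where p: "P = Suc p" "l \<le> p"
    using P(1) by (cases P) auto
  have gp: "g p = a" using P(3)[of p] p by simp
  have last: "(g(p := g p - 2)) (j - 1) = a - 2"
  proof (cases "j = P")
    case True
    then show ?thesis using p gp by simp
  next
    case False
    then have "P \<le> j - 1" "j - 1 < j" "l \<le> j - 1" "j - 1 \<noteq> p"
      using p \<open>P \<le> j\<close> by auto
    then show ?thesis
      using j(3)[of "j - 1"] g_le[of P "j - 1"] gP by simp
  qed
  have good: "odd (e + (a - 2))" using a hl by presburger
  have "p = l"
  proof (rule ccontr)
    assume "p \<noteq> l"
    then show False
      using p gp gP a gap2 \<open>P \<le> j\<close> last good j(2)
      by (intro no_drop_one[of p j]) auto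
  qed
  define s where "s = g j"
  have cases: "odd (e + s) \<and> s + 4 \<le> a \<and> h = g(l := a - 2, j := s + 2) \<or>
    even (e + s) \<and> even (j + f) \<and> g (Suc j) = s \<and> h = g(l := a - 2, j := s + 1, Suc j := s + 1)"
    using drop_one[of p j "g(p := g p - 2)", unfolded last] p gp gP a gap2 \<open>P \<le> j\<close> good j(2) hl \<open>p = l\<close>
    by (auto simp: s_def)
  have inner: "g i = a - 2" if "l < i" "i < j" for i
    using j(3)[of i] g_le[of P i] gP that p \<open>p = l\<close> by simp
  show ?thesis
  proof (cases "j = Suc l")
    case True
    show ?thesis
      using cases
    proof (elim disjE conjE)
      assume 1: "odd (e + s)" "s + 4 \<le> a" "h = g(l := a - 2, j := s + 2)"
      have "\<exists>n. a = s + 2 * n \<and> 2 \<le> n"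
        using 1(1,2) a by presburger
      then obtain n where "a = s + 2 * n" "2 \<le> n" by blast
      then show ?thesis
        using 1 True by (intro classified_b[of e s n]) (auto simp: a_def s_def)
    next
      assume 2: "even (e + s)" "g (Suc j) = s" "h = g(l := a - 2, j := s + 1, Suc j := s + 1)"
      have "\<exists>n. a = s + (2 * n + 1) \<and> 1 \<le> n"
        using 2(1) a j(2) unfolding s_def by presburger
      then obtain n where "a = s + (2 * n + 1)" "1 \<le> n" by blast
      then show ?thesis
        using 2 True lf by (intro classified_c[of l f e s n]) (auto simp: a_def s_def)
    qed
  next
    case False
    define q where "q = j - Suc l"
    have q: "j = Suc l + q" "0 < q" using False j(1) by (auto simp: q_def)
    obtain i where i: "j = Suc i" "l < i" using q by (cases j) auto
    have step: "a - 2 \<le> s + 2" "odd (e + s) \<Longrightarrow> odd (i + f)"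
      using inner_step[of i] inner[of i] i good j(2) gap2[of j] by (auto simp: s_def)
    show ?thesis
      using cases
    proof (elim disjE conjE)
      assume 1: "odd (e + s)" "s + 4 \<le> a" "h = g(l := a - 2, j := s + 2)"
      then have "a = s + 4" "even q"
        using step i q lf by auto
      then show ?thesis
        using 1 lf q inner by (intro classified_h_sp[of l f e s q j]) (auto simp: a_def s_def)
    next
      assume 2: "even (e + s)" "even (j + f)" "g (Suc j) = s" "h = g(l := a - 2, j := s + 1, Suc j := s + 1)"
      have "a = s + 3"
        using 2(1) a j(2) step(1) unfolding s_def by presburger
      moreover have "even q" using 2(2) q(1) lf by presburger
      ultimately show ?thesis
        using 2 lf q inner by (intro classified_f1_sp[of l f e s q j]) (auto simp: a_def s_def)
    qed
  qed
qed

text \<open>The plateau consists of couples, and the last of these can give a box from each of its rows to the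
  first row \<open>j\<close> of length less than \<open>a - 1\<close>; it is therefore the couple of row \<open>l\<close>. The rows in between have the good
  value \<open>a - 1\<close>, and \<open>inner_step\<close> applies to them. The outcomes are types \<open>d\<close> and \<open>e\<close> without and
  \<open>f2_sp\<close> and \<open>h\<close> with such rows.\<close>

lemma classified_bad_pair:
  assumes lf: "even (l + f)" and a: "even (e + g l)"
  shows "classified e f l g h"
proof -
  define a where "a = g l"
  have bad: "even (e + a)" using a by (simp add: a_def)
  have hl: "h l + 1 \<le> a" using differ by (simp add: a_def)
  have good: "odd (e + (a - 1))" using bad hl by presburger
  obtain j where j: "l < j" "g j < a - 1" "\<And>i. l \<le> i \<Longrightarrow> i < j \<Longrightarrow> a - 1 \<le> g i"
    by (rule first_below[of "a - 1"]) (use hl in \<open>auto simp: a_def\<close>)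
  obtain P where P: "l < P" "g P < a" "\<And>i. l \<le> i \<Longrightarrow> i < P \<Longrightarrow> g i = a"
    unfolding a_def by (rule plateau, blast)
  have "P \<le> j"
    using P(3)[of j] j by (cases "P \<le> j") auto
  have "g (Suc l) = a"
    using g_pair[OF lf] a by (auto simp: a_def)
  then have "Suc l < P" using P(1,2) by (metis Suc_lessI less_irrefl)
  then obtain p where p: "P = Suc (Suc p)" "l \<le> p"
    by (metis Suc_leI Suc_le_D Suc_le_mono)
  have gp: "g p = a" "g (Suc p) = a" using P(3)[of p] P(3)[of "Suc p"] p by auto
  have "odd (Suc p + f)"
    using g_pair[of "Suc p"] gp bad P(2) p(1) by auto
  then have pf: "even (p + f)" by simp
  have gap1: "1 \<le> gap (Suc p)" and gapP: "2 \<le> gap P"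
  proof -
    have "h l < g i" if "l \<le> i" "i < P" for i
      using P(3)[of i] hl that by simp
    then show "1 \<le> gap (Suc p)" "2 \<le> gap P"
      using gap_ge_growth[of P "Suc p"] gap_ge_growth[of P P] p by simp_all
  qed
  have gap2: "2 \<le> gap t" if "Suc p < t" "t \<le> j" for t
  proof -
    have "h l \<le> g i" if "i < j" "P \<le> i" for i
      using j(3)[of i] that hl P(1) by simp
    then show ?thesis
      using gap_mono_range[of P t] gapP P(1) that p by force
  qed
  let ?k = "g(p := g p - 1, Suc p := g p - 1)"
  have last: "?k (j - 1) = a - 1"
  proof (cases "j = P")
    case True
    then show ?thesis using p gp by simp
  next
    case False
    then have "P \<le> j - 1" "j - 1 < j" "l \<le> j - 1" "j - 1 \<noteq> p" "j - 1 \<noteq> Suc p"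
      using p \<open>P \<le> j\<close> by auto
    moreover from this have "g (j - 1) = a - 1"
      using j(3)[of "j - 1"] g_le[of P "j - 1"] P(2) by arith
    ultimately show ?thesis by simp
  qed
  have "p = l"
  proof (rule ccontr)
    assume "p \<noteq> l"
    then show False
      using p gp P(2) gap1 gap2 \<open>P \<le> j\<close> last good j(2) pf
      by (intro no_drop_pair[of p j]) auto
  qed
  define s where "s = g j"
  have cases: "odd (e + s) \<and> s + 3 \<le> a \<and> h = g(l := a - 1, Suc l := a - 1, j := s + 2) \<or>
    even (e + s) \<and> even (j + f) \<and> g (Suc j) = s \<and>
      h = g(l := a - 1, Suc l := a - 1, j := s + 1, Suc j := s + 1)"
    using drop_pair[of p j ?k, unfolded last] p gp P(2) gap1 gap2 \<open>P \<le> j\<close> good j(2) pf hl \<open>p = l\<close>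
    by (auto simp: s_def)
  have inner: "g i = a - 1" if "Suc l < i" "i < j" for i
    using j(3)[of i] g_le[of P i] P(2) that p \<open>p = l\<close> by simp
  have s: "s < a - 1" using j(2) by (simp add: s_def)
  show ?thesis
  proof (cases "j = l + 2")
    case True
    show ?thesis
      using cases
    proof (elim disjE conjE)
      assume 1: "odd (e + s)" "s + 3 \<le> a" "h = g(l := a - 1, Suc l := a - 1, j := s + 2)"
      have "\<exists>n. a = s + (2 * n + 1) \<and> 1 \<le> n"
        using 1(1,2) bad by presburger
      then obtain n where "a = s + (2 * n + 1)" "1 \<le> n" by blast
      then show ?thesis
        using 1 True lf gp \<open>p = l\<close>
        by (intro classified_d[of l f e s n]) (auto simp: a_def s_def)
    next
      assume 2: "even (e + s)" "g (Suc j) = s"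
        "h = g(l := a - 1, Suc l := a - 1, j := s + 1, Suc j := s + 1)"
      have "\<exists>n. a = s + 2 * n \<and> 1 \<le> n"
        using 2(1) bad s by presburger
      then obtain n where "a = s + 2 * n" "1 \<le> n" by blast
      then show ?thesis
        using 2 True lf gp \<open>p = l\<close>
        by (intro classified_e[of l f e s n]) (auto simp: a_def s_def)
    qed
  next
    case False
    define q where "q = j - (l + 2)"
    have q: "j = l + 2 + q" "0 < q" using False \<open>P \<le> j\<close> p \<open>p = l\<close> by (auto simp: q_def)
    obtain i where i: "j = Suc i" "Suc l < i" using q by (cases j) auto
    have step: "a - 1 \<le> s + 2" "odd (e + s) \<Longrightarrow> odd (i + f)"
      using inner_step[of i] inner[of i] i good j(2) gap2[of j] \<open>p = l\<close> by (auto simp: s_def)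
    show ?thesis
      using cases
    proof (elim disjE conjE)
      assume 1: "odd (e + s)" "s + 3 \<le> a" "h = g(l := a - 1, Suc l := a - 1, j := s + 2)"
      then have "a = s + 3" "even q"
        using step i q lf by auto
      then show ?thesis
        using 1 lf q inner gp \<open>p = l\<close>
        by (intro classified_f2_sp[of l f e s q j]) (auto simp: a_def s_def)
    next
      assume 2: "even (e + s)" "even (j + f)" "g (Suc j) = s"
        "h = g(l := a - 1, Suc l := a - 1, j := s + 1, Suc j := s + 1)"
      have "a = s + 2"
        using 2(1) bad s step(1) by presburger
      moreover have "even q" using 2(2) q(1) lf by presburger
      ultimately show ?thesis
        using 2 lf q inner gp \<open>p = l\<close>
        by (intro classified_h[of l f e s q j]) (auto simp: a_def s_def)
    qed
  qed
qed

text \<open>The plateau ends inside a couple \<open>(a, s)\<close> of good values. If \<open>a = s + 2\<close>, the couple can be levelled,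
  which gives type \<open>a\<close>. Otherwise two boxes move within the couple, which gives type \<open>b\<close>; the gap
  in its middle is at least two because \<open>h l = a - 1\<close> would be bad, would therefore occur twice, and
  would make the second row of \<open>h\<close> exceed \<open>s\<close> by too much.\<close>

lemma classified_split_pair:
  assumes lf: "even (l + f)" and a: "odd (e + g l)"
    and P: "g (Suc p) < g l" "\<And>i. l \<le> i \<Longrightarrow> i \<le> p \<Longrightarrow> g i = g l" and p: "l \<le> p" "even (p + f)"
  shows "classified e f l g h"
proof -
  define a where "a = g l"
  have good: "odd (e + a)" using a by (simp add: a_def)
  have gp: "g p = a" using P(2)[of p] p by (simp add: a_def)
  define s where "s = g (Suc p)"
  have s: "odd (e + s)" "s < a"
    using g_pair[OF p(2)] gp P(1) by (auto simp: s_def a_def)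
  then have s2: "s + 2 \<le> a" using good by presburger
  have growth: "int (Suc p) - int l \<le> gap (Suc p)"
  proof (rule gap_ge_growth)
    show "h l < g i" if "l \<le> i" "i < Suc p" for i
      using P(2)[of i] differ that by simp
  qed (use p in auto)
  show ?thesis
  proof (cases "a = s + 2")
    case True
    have "p = l"
      using no_level[of p] level[of p] p True gp growth by (force simp: s_def)
    moreover have "h = g(p := g p - 1, Suc p := g p - 1)"
      using level[of p] p True gp growth by (force simp: s_def)
    ultimately show ?thesis
      using True lf s gp by (intro classified_a[of l f e s]) (auto simp: s_def)
  next
    case False
    then have s4: "s + 4 \<le> a" using s2 s good by presburger
    have gap2: "2 \<le> gap (Suc p)"
    proof (cases "p = l")
      case False
      then show ?thesis using growth p by simp
    next
      case True
      have "h (Suc l) = a - 1" if "h l = a - 1"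
      proof -
        have "even (e + h l)" using good s4 that by presburger
        then show ?thesis using h_pair[OF lf] that by auto
      qed
      moreover have "gap (Suc l) = int a - int (h l)" "gap (Suc (Suc l)) = int a - int (h l) + int s - int (h (Suc l))"
        using gap_start[of l] True by (simp_all add: gap_Suc a_def s_def)
      ultimately show ?thesis
        using gap_nonneg[of "Suc (Suc l)"] differ s4 True by (cases "h l = a - 1") (auto simp: a_def)
    qed
    have step: "odd (e + (a - 2))" "s < a - 2" using good s4 by presburger+
    have "p = l"
    proof (rule ccontr)
      assume "p \<noteq> l"
      then show False
        using p gp s2 good gap2 step by (intro no_drop_one[of p "Suc p"]) (auto simp: s_def le_Suc_eq)
    qed
    have "h = g(l := a - 2, Suc l := s + 2)"
      using drop_one[of p "Suc p" "g(p := g p - 2)"] p gp s2 good gap2 step s \<open>p = l\<close>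
      by (auto simp: s_def le_Suc_eq)
    moreover have "\<exists>n. a = s + 2 * n \<and> 2 \<le> n"
      using good s s4 by presburger
    then obtain n where "a = s + 2 * n" "2 \<le> n" by blast
    ultimately show ?thesis
      using s \<open>p = l\<close> by (intro classified_b[of e s n]) (auto simp: a_def s_def)
  qed
qed

text \<open>The plateau consists of couples of the good value \<open>a\<close>, followed by couples of the bad value \<open>a - 1\<close>,
  if any, up to a couple starting at \<open>j\<close>. The last couple before \<open>j\<close> can give two boxes to row \<open>j\<close>
  or row \<open>j + 1\<close> without touching row \<open>l\<close>, as soon as one of these is shorter than \<open>a - 2\<close>. So both equal
  \<open>a - 2\<close>. Then the last couple of the plateau can give one box from each row to the couple at \<open>j\<close>,
  which leads to type \<open>g_sp\<close>.\<close>

lemma classified_good_pair: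
  assumes lf: "even (l + f)" and a: "odd (e + g l)"
    and P: "g (Suc (Suc p)) < g l" "\<And>i. l \<le> i \<Longrightarrow> i \<le> Suc p \<Longrightarrow> g i = g l"
    and p: "l \<le> p" "even (p + f)"
  shows "classified e f l g h"
proof -
  define a where "a = g l"
  define P where "P = Suc (Suc p)"
  have good: "odd (e + a)" using a by (simp add: a_def)
  have hl: "h l + 1 \<le> a" using differ by (simp add: a_def)
  have bad: "even (e + (a - 1))" using good hl by presburger
  have gP: "g P < a" and gp: "g p = a" "g (Suc p) = a"
    using P(1) P(2)[of p] P(2)[of "Suc p"] p by (simp_all add: a_def P_def)
  obtain j where j: "l < j" "g j < a - 1" "\<And>i. l \<le> i \<Longrightarrow> i < j \<Longrightarrow> a - 1 \<le> g i"
    by (rule first_below[of "a - 1"]) (use hl in \<open>auto simp: a_def\<close>)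
  have "P \<le> j"
    using assms(4)[of j] j(1,2) by (cases "P \<le> j") (auto simp: P_def a_def)
  have inner: "g i = a - 1" if "P \<le> i" "i < j" for i
    using j(3)[of i] g_le[of P i] gP that p by (simp add: P_def)
  have gap1: "1 \<le> gap (Suc p)" and gapP: "2 \<le> gap P"
  proof -
    have "h l < g i" if "l \<le> i" "i < P" for i
      using assms(4)[of i] differ that by (simp add: P_def)
    then show "1 \<le> gap (Suc p)" "2 \<le> gap P"
      using gap_ge_growth[of P "Suc p"] gap_ge_growth[of P P] p by (simp_all add: P_def)
  qed
  have gap2: "2 \<le> gap t" if "P \<le> t" "t \<le> j" for t
  proof -
    have "h l \<le> g i" if "i < j" "P \<le> i" for i
      using inner[of i] that hl by simp
    then show ?thesis
      using gap_mono_range[of P t] gapP that p by (force simp: P_def)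
  qed
  have jf: "even (j + f)"
  proof (cases "j = P")
    case False
    then obtain i where i: "j = Suc i" "P \<le> i" using \<open>P \<le> j\<close> by (cases j) auto
    then show ?thesis
      using g_pair[of i] inner[of i] bad j(2) by auto
  qed (use p in \<open>simp add: P_def\<close>)
  \<comment> \<open>The donor is the last couple before \<open>j\<close>: its second row alone if the value is \<open>a\<close>, both rows if
    it is \<open>a - 1\<close>. Either way row \<open>l\<close> is kept, and the row before the receiving row \<open>x\<close> becomes \<open>a - 2\<close>.\<close>
  have move_inside: False
    if x: "x = j \<or> x = Suc j \<and> g j = a - 2" "g x < a - 2" "2 \<le> gap x" for x
  proof (cases "j = P")
    case True
    show False
    proof (rule no_drop_one[of "Suc p" x])
      show "odd (e + (g(Suc p := g (Suc p) - 2)) (x - 1))"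
        "g x < (g(Suc p := g (Suc p) - 2)) (x - 1)"
        using x True gp good by (auto simp: P_def)
      show "2 \<le> gap t" if "Suc p < t" "t \<le> x" for t
        using that x True gap2[of t] by (auto simp: P_def le_Suc_eq)
      show "g (Suc (Suc p)) + 2 \<le> g (Suc p)"
        using j(2) True gp by (simp add: P_def)
    qed (use x True p gp good in \<open>auto simp: P_def\<close>)
  next
    case False
    have "even (P + f)" using p by (simp add: P_def)
    then have "P + 2 \<le> j" using False \<open>P \<le> j\<close> jf
      by (metis Suc_leI add_2_eq_Suc' even_Suc le_neq_implies_less add_Suc)
    then have "j = Suc (Suc (j - 2))" "P \<le> j - 2" by simp_all
    then obtain i where i: "j = Suc (Suc i)" "P \<le> i" by blast
    have gi: "g i = a - 1" "g (Suc i) = a - 1" using inner i by auto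
    show False
    proof (rule no_drop_pair[of i x])
      show "odd (e + (g(i := g i - 1, Suc i := g i - 1)) (x - 1))"
        "g x < (g(i := g i - 1, Suc i := g i - 1)) (x - 1)"
        using x i gi bad j(2) by auto
      show "2 \<le> gap t" if "Suc i < t" "t \<le> x" for t
        using that x i gap2[of t] by (auto simp: le_Suc_eq)
      show "1 \<le> gap (Suc i)" using gap2[of "Suc i"] i by simp
    qed (use x i gi jf p j(2) in \<open>auto simp: P_def\<close>)
  qed
  have gj: "g j = a - 2"
    using move_inside[of j] j(2) gap2[of j] \<open>P \<le> j\<close> by force
  have a2: "2 \<le> a" using j(2) by simp
  have gj': "g (Suc j) = a - 2"
  proof (rule ccontr)
    assume ne: "g (Suc j) \<noteq> a - 2"
    then have odd: "odd (e + g (Suc j))" "g (Suc j) < a - 2"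
      using g_pair[OF jf] gj g_le[of j "Suc j"] by auto
    then have 4: "g (Suc j) + 4 \<le> a" using good by presburger
    have "h j \<le> a - 1" using h_le[of l j] j(1) hl by simp
    \<comment> \<open>a gap of one after row \<open>j\<close> would force \<open>h\<close> to have the bad couple \<open>(a - 1, a - 1)\<close> there\<close>
    have "h (Suc j) = a - 1" if "h j = a - 1"
      using h_pair[OF jf] bad that by metis
    then have "2 \<le> gap (Suc j)"
      using gap_nonneg[of "Suc (Suc j)"] gap2[of j] \<open>P \<le> j\<close> \<open>h j \<le> a - 1\<close> 4 gj
      by (cases "h j = a - 1") (auto simp: gap_Suc)
    then show False
      using move_inside[of "Suc j"] gj odd by auto
  qed
  let ?k1 = "g(p := a - 1, Suc p := a - 1)"
  let ?k = "?k1(j := a - 1, Suc j := a - 1)"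
  have h: "h = ?k"
  proof (rule squeeze)
    have "special_seq e f ?k1"
      using special_g p(2)
    proof (rule special_seq_upd_pair)
      show "p = 0 \<or> a - 1 \<le> g (p - 1)"
        using g_le[of "p - 1" p] gp by auto
    qed (use gP in \<open>simp add: P_def\<close>)
    then show "special_seq e f ?k"
      using jf
    proof (rule special_seq_upd_pair)
      show "?k1 (Suc (Suc j)) \<le> a - 1"
        using g_le[of j "Suc (Suc j)"] gj \<open>P \<le> j\<close> by (simp add: P_def)
      show "j = 0 \<or> a - 1 \<le> ?k1 (j - 1)"
        using inner[of "j - 1"] \<open>P \<le> j\<close> by (cases "j = P") (auto simp: P_def)
    qed
    fix t
    have ps: "psum ?k t = psum g t - (if p < t then 1 else 0) - (if Suc p < t then 1 else 0)
        + (if j < t then 1 else 0) + (if Suc j < t then 1 else 0)"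
      using gp gj gj' a2 \<open>P \<le> j\<close> by (simp add: psum_fun_upd P_def)
    have "1 \<le> gap (Suc j)"
      using gap2[of j] h_le[of l j] j(1) hl gj a2 \<open>P \<le> j\<close> by (simp add: gap_Suc)
    then have "(if p < t then 1 else 0) + (if Suc p < t then 1 else 0)
        - (if j < t then 1 else 0) - (if Suc j < t then 1 else 0) \<le> gap t"
      using gap1 gap2[of t] gap_nonneg[of t] \<open>P \<le> j\<close> unfolding P_def
      by (cases "t = Suc p"; cases "t = Suc j") (simp_all del: psum_Suc)
    moreover have "(if j < t then 1 else 0) + (if Suc j < t then 1 else 0)
        \<le> (if p < t then 1 else 0) + (if Suc p < t then 1 else (0::int))"
      using \<open>P \<le> j\<close> by (simp add: P_def)
    ultimately show "psum h t \<le> psum ?k t" "psum ?k t \<le> psum g t"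
      unfolding ps gap_def by linarith+
  next
    have "?k (Suc j) \<noteq> g (Suc j)"
      using gj' a2 by simp
    then show "?k \<noteq> g" by metis
  qed
  have "p = l"
  proof (rule ccontr)
    assume "p \<noteq> l"
    then have "h l = g l" using p j(1) by (simp add: h)
    then show False using differ by simp
  qed
  define s where "s = a - 2"
  define q where "q = j - (l + 2)"
  have "a = s + 2" using a2 by (simp add: s_def)
  show ?thesis
  proof (rule classified_g_sp[of l f e s q j])
    show "j = l + 2 + q" using \<open>P \<le> j\<close> \<open>p = l\<close> by (simp add: q_def P_def)
    then show "even q" using jf lf by presburger
    show "odd (e + s)" using good \<open>a = s + 2\<close> by simp
    show "g i = s + 1" if "Suc l < i" "i < j" for i
      using inner[of i] that \<open>p = l\<close> \<open>a = s + 2\<close> by (simp add: P_def)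
    show "h = g(l := s + 1, Suc l := s + 1, j := s + 1, Suc j := s + 1)"
      using h \<open>p = l\<close> \<open>a = s + 2\<close> by simp
  qed (use lf gp gj gj' \<open>p = l\<close> \<open>a = s + 2\<close> in simp_all)
qed

theorem classified_minimal_pair: "classified e f l g h"
proof (cases "even (l + f)")
  case lf: True
  show ?thesis
  proof (cases "even (e + g l)")
    case good: False
    obtain P where P: "l < P" "g P < g l" "\<And>i. l \<le> i \<Longrightarrow> i < P \<Longrightarrow> g i = g l"
      by (rule plateau, blast)
    show ?thesis
    proof (cases "even (P + f)")
      case False
      then obtain p where p: "P = Suc p" "even (p + f)" using P(1) by (cases P) auto
      show ?thesis
      proof (rule classified_split_pair[OF lf good])
        show "g i = g l" if "l \<le> i" "i \<le> p" for i
          using P(3)[of i] that p by simp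
      qed (use P(1,2) p in auto)
    next
      case even: True
      then have "Suc l < P"
        using P(1) lf by (cases "P = Suc l") auto
      then have "P = Suc (Suc (P - 2))" "l \<le> P - 2" by simp_all
      then obtain p where p: "P = Suc (Suc p)" "l \<le> p" by blast
      show ?thesis
      proof (rule classified_good_pair[OF lf good])
        show "g i = g l" if "l \<le> i" "i \<le> Suc p" for i
          using P(3)[of i] that p by simp
      qed (use P(1,2) p even in auto)
    qed
  qed (rule classified_bad_pair[OF lf])
qed (rule classified_unpaired)

end

section \<open>Removing common rows and columns\<close>

lemma row_drop: "row (drop l lam) i = row lam (l + i)"
  by (simp add: row_def less_diff_conv add.commute)

lemma partition_of_drop:
  assumes "partition_of N lam"
  shows "partition_of (sum_list (drop l lam)) (drop l lam)"
  using assms by (auto simp: partition_of_def sorted_wrt_drop dest: in_set_dropD)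

text \<open>The rows compared by \<^const>\<open>common_rows\<close> must exist in both lists; row \<open>l\<close> of \<open>lam\<close> is positive, so all
  earlier rows do.\<close>

lemma common_rows_eqI:
  assumes part: "partition_of N lam" "partition_of M mu"
    and eq: "\<And>i. i < l \<Longrightarrow> row mu i = row lam i" and less: "row mu l < row lam l"
  shows "common_rows lam mu = l"
  unfolding common_rows_def
proof (rule Greatest_equality)
  have lam: "i < length lam" if "i \<le> l" for i
    using partition_of_row_antimono[OF part(1) that] less row_pos_iff[OF part(1), of i] by simp
  have mu: "i < length mu" if "i < l" for i
    using lam[of i] eq[of i] that row_pos_iff[OF part(1), of i] row_pos_iff[OF part(2), of i] by simp
  have "l \<le> length mu"
    using mu[of "length mu"] by (meson less_irrefl not_le)
  then show "l \<le> length lam \<and> l \<le> length mu \<and> (\<forall>i<l. lam ! i = mu ! i)"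
    using less_imp_le[OF lam[of l]] lam mu eq by (auto simp: row_def)
next
  fix y assume y: "y \<le> length lam \<and> y \<le> length mu \<and> (\<forall>i<y. lam ! i = mu ! i)"
  show "y \<le> l"
  proof (rule ccontr)
    assume "\<not> y \<le> l"
    then have "row lam l = row mu l" using y by (simp add: row_def)
    then show False using less by simp
  qed
qed

lemma remove_cols_eqI:
  assumes xs: "0 \<notin> set xs" and at: "\<And>i. i < length xs \<Longrightarrow> row A i = s + xs ! i"
    and beyond: "\<And>i. length xs \<le> i \<Longrightarrow> row A i \<le> s"
  shows "remove_cols s A = xs"
proof -
  define m where "m = length xs"
  have len: "i < length A" if "i < m" for i
  proof -
    have "xs ! i \<noteq> 0"
      using that xs nth_mem[of i xs] unfolding m_def by metis
    then show ?thesis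
      using at[of i] that by (auto simp: row_def m_def split: if_splits)
  qed
  then have m: "m \<le> length A"
    by (meson less_irrefl not_le)
  have front: "map (\<lambda>x. x - s) (take m A) = xs"
  proof (rule nth_equalityI)
    fix i assume "i < length (map (\<lambda>x. x - s) (take m A))"
    then show "map (\<lambda>x. x - s) (take m A) ! i = xs ! i"
      using at[of i] m by (simp add: row_def m_def)
  qed (use m in \<open>simp add: m_def\<close>)
  have tail: "x \<le> s" if x: "x \<in> set (drop m A)" for x
  proof -
    obtain i where "i < length (drop m A)" "drop m A ! i = x"
      using x unfolding in_set_conv_nth by blast
    then have "x = row A (m + i)"
      using m by (auto simp: row_def)
    then show ?thesis using beyond[of "m + i"] by (simp add: m_def)
  qed
  have "remove_cols s A = filter (\<lambda>x. 0 < x) (map (\<lambda>x. x - s) (take m A @ drop m A))"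
    unfolding remove_cols_def by simp
  also have "\<dots> = filter (\<lambda>x. 0 < x) xs @ filter (\<lambda>x. 0 < x) (map (\<lambda>x. x - s) (drop m A))"
    unfolding map_append filter_append front ..
  also have "filter (\<lambda>x. 0 < x) (map (\<lambda>x. x - s) (drop m A)) = []"
    using tail by (simp add: filter_empty_conv)
  also have "filter (\<lambda>x. 0 < x) xs = xs"
    using xs by (auto intro!: filter_True intro: gr0I)
  finally show ?thesis by simp
qed

context
  fixes l s N M :: nat and lam mu xs ys :: "nat list"
  assumes part: "partition_of N lam" "partition_of M mu"
    and red: "reduces_to l s (row lam) (row mu) xs ys"
begin

lemma reduces_to_rows:
  shows "i < length xs \<Longrightarrow> row (drop l lam) i = s + xs ! i"
    and "length xs \<le> i \<Longrightarrow> row (drop l lam) i \<le> s"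
    and "i < length ys \<Longrightarrow> row (drop l mu) i = s + ys ! i"
    and "length ys \<le> i \<Longrightarrow> row (drop l mu) i \<le> s"
proof -
  have len: "length xs < length ys"
    and at: "\<And>i. i < length ys \<Longrightarrow> row lam (l + i) = s + row xs i \<and> row mu (l + i) = s + ys ! i"
    and rest: "\<And>i. l + length ys \<le> i \<Longrightarrow> row mu i = row lam i"
    using red by (simp_all add: reduces_to_def)
  show "i < length xs \<Longrightarrow> row (drop l lam) i = s + xs ! i" for i
    using at[of i] len by (simp add: row_drop) (simp add: row_def)
  have "row lam (l + length xs) = s"
    using at[OF len] by (simp add: row_def)
  then show small: "length xs \<le> i \<Longrightarrow> row (drop l lam) i \<le> s" for i
    using partition_of_row_antimono[OF part(1), of "l + length xs" "l + i"] by (simp add: row_drop)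
  show "i < length ys \<Longrightarrow> row (drop l mu) i = s + ys ! i" for i
    using at[of i] by (simp add: row_drop)
  show "length ys \<le> i \<Longrightarrow> row (drop l mu) i \<le> s" for i
    using small[of i] len rest[of "l + i"] by (simp add: row_drop)
qed

lemma remove_cols_reduces_to:
  "remove_cols s (drop l lam) = xs" "remove_cols s (drop l mu) = ys"
proof -
  have nz: "0 \<notin> set xs" "0 \<notin> set ys"
    using red by (simp_all add: reduces_to_def)
  show "remove_cols s (drop l lam) = xs"
    using nz(1) reduces_to_rows(1,2) by (rule remove_cols_eqI)
  show "remove_cols s (drop l mu) = ys"
    using nz(2) reduces_to_rows(3,4) by (rule remove_cols_eqI)
qed

lemma common_cols_reduces_to: "common_cols (drop l lam) (drop l mu) = s"
  unfolding common_cols_def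
proof (rule Greatest_equality)
  note parts = partition_of_drop[OF part(1), of l] partition_of_drop[OF part(2), of l]
  show "\<forall>j\<in>{1..s}. height (drop l lam) j = height (drop l mu) j"
  proof
    fix j assume j: "j \<in> {1..s}"
    show "height (drop l lam) j = height (drop l mu) j"
    proof (rule height_eqI[OF parts(1)])
      fix i
      have "j \<le> row (drop l lam) i \<longleftrightarrow> j \<le> row (drop l mu) i"
      proof (cases "i < length ys")
        case True
        then have "s \<le> row lam (l + i)" "s \<le> row mu (l + i)"
          using red by (simp_all add: reduces_to_def)
        then show ?thesis using j by (simp add: row_drop)
      next
        case False
        then have "row mu (l + i) = row lam (l + i)"
          using red by (simp add: reduces_to_def)
        then show ?thesis by (simp add: row_drop)
      qed
      then show "j \<le> row (drop l lam) i \<longleftrightarrow> i < height (drop l mu) j"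
        using less_height_iff[OF parts(2), of j i] j by simp
    qed (use j in simp)
  qed
  have nz: "0 \<notin> set xs" "0 \<notin> set ys"
    using red by (simp_all add: reduces_to_def)
  have "height (drop l lam) (Suc s) = length xs"
  proof (rule height_eqI[OF parts(1)])
    show "Suc s \<le> row (drop l lam) i \<longleftrightarrow> i < length xs" for i
      using reduces_to_rows(1,2)[of i] nz(1) nth_mem[of i xs]
      by (cases "i < length xs"; cases "xs ! i") auto
  qed simp
  moreover have "height (drop l mu) (Suc s) = length ys"
  proof (rule height_eqI[OF parts(2)])
    show "Suc s \<le> row (drop l mu) i \<longleftrightarrow> i < length ys" for i
      using reduces_to_rows(3,4)[of i] nz(2) nth_mem[of i ys]
      by (cases "i < length ys"; cases "ys ! i") auto
  qed simp
  ultimately have ne: "height (drop l lam) (Suc s) \<noteq> height (drop l mu) (Suc s)"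
    using red by (simp add: reduces_to_def)
  fix y assume y: "\<forall>j\<in>{1..y}. height (drop l lam) j = height (drop l mu) j"
  show "y \<le> s"
  proof (rule ccontr)
    assume "\<not> y \<le> s"
    then have "Suc s \<in> {1..y}" by simp
    then show False using y ne by blast
  qed
qed

end

lemma mult_eq_count: "mult lam s = count_list lam s"
  by (simp add: mult_def count_list_eq_length_filter length_filter_conv_card eq_commute)

lemma count_list_replicate: "count_list (replicate n x) y = (if x = y then n else 0)"
  by (induction n) auto

lemma sorted_wrt_replicate: "sorted_wrt (\<ge>) (replicate n (x :: nat))"
  by (induction n) auto

lemma is_entry_ambient:
  assumes "is_entry t e f l s xs ys"
  shows "case ambient t of (e', M) \<Rightarrow> [e' = e + s] (mod 2) \<and>
    xs \<in> eps_partitions e' M \<and> ys \<in> eps_partitions e' M"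
  using assms
  by (cases t) (auto simp: cong_2_iff eps_partitions_def partition_of_def mult_eq_count
      count_list_replicate sorted_wrt_append sorted_wrt_replicate sum_list_replicate add.commute)

lemma is_entry_unique:
  assumes "is_entry t e f l s xs ys" "is_entry t' e f l s xs ys"
  shows "t = t'"
  using assms by (cases t; cases t') auto

section \<open>Dimensions\<close>

lemma sum_odds: "(\<Sum>i<h. 2 * i + 1) = h\<^sup>2" for h :: nat
  by (induction h) (auto simp: power2_eq_square)

lemma sum_of_bool_le: "(\<Sum>j=1..N. of_bool (j \<le> r)) = min N r" for r :: nat
  by (induction N) auto

text \<open>The square of a height \<open>h\<close> is the sum of the first \<open>h\<close> odd numbers. Summing over the boxes of the
  diagram by rows instead of by columns, each box in row \<open>i\<close> contributes \<open>2 i + 1\<close>.\<close>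

lemma sum_height_squares:
  assumes part: "partition_of N lam" and n: "length lam \<le> n"
  shows "(\<Sum>j=1..N. (height lam j)\<^sup>2) = (\<Sum>i<n. (2 * i + 1) * row lam i)"
proof -
  have "(height lam j)\<^sup>2 = (\<Sum>i<n. (2 * i + 1) * of_bool (j \<le> row lam i))"
    if j: "j \<in> {1..N}" for j
  proof -
    have "height lam j \<le> n"
    proof -
      have "height lam j \<le> card {..<length lam}"
        unfolding height_def by (intro card_mono) auto
      then show ?thesis using n by simp
    qed
    moreover have iff: "i < height lam j \<longleftrightarrow> j \<le> row lam i" for i
      using less_height_iff[OF part] j by simp
    ultimately have cut: "{i \<in> {..<n}. j \<le> row lam i} = {..<height lam j}"
      by (auto simp flip: iff)
    have "(\<Sum>i<n. (2 * i + 1) * of_bool (j \<le> row lam i)) =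
        (\<Sum>i\<in>{i \<in> {..<n}. j \<le> row lam i}. 2 * i + 1)"
      by (subst sum.inter_filter) (auto intro!: sum.cong)
    then show ?thesis
      unfolding cut sum_odds by simp
  qed
  then have "(\<Sum>j=1..N. (height lam j)\<^sup>2) = (\<Sum>j=1..N. \<Sum>i<n. (2 * i + 1) * of_bool (j \<le> row lam i))"
    by (intro sum.cong) auto
  also have "\<dots> = (\<Sum>i<n. (2 * i + 1) * (\<Sum>j=1..N. of_bool (j \<le> row lam i)))"
    by (subst sum.swap) (simp only: sum_distrib_left)
  finally have "(\<Sum>j=1..N. (height lam j)\<^sup>2) =
    (\<Sum>i<n. (2 * i + 1) * (\<Sum>j=1..N. of_bool (j \<le> row lam i)))" .
  moreover have "(\<Sum>j=1..N. of_bool (j \<le> row lam i)) = row lam i" for i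
  proof -
    have "row lam i \<le> N"
    proof (cases "i < length lam")
      case True
      then show ?thesis
        using part member_le_sum_list[OF nth_mem[OF True]] by (simp add: row_def partition_of_def)
    qed (simp add: row_def)
    then show ?thesis unfolding sum_of_bool_le by simp
  qed
  ultimately show ?thesis by (simp only:)
qed

lemma sum_even_odd:
  "(\<Sum>i<n. of_bool (even (g i))) + (\<Sum>i<n. of_bool (odd (g i))) = int n" for g :: "nat \<Rightarrow> nat"
  by (induction n) auto

text \<open>Rows beyond the length of the partition are zero and count as bad rows if \<open>e = 0\<close>. Both weights are
  taken over the same number \<open>n\<close> of rows, so this has no effect on the difference.\<close>

lemma orbit_codim_weight:
  assumes part: "partition_of N lam" "partition_of N mu"
    and n: "length lam \<le> n" "length mu \<le> n" and e: "e \<le> 1"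
  shows "orbit_codim e lam mu = of_int (weight e n (row mu) - weight e n (row lam)) / 2"
proof -
  have dim: "orbit_dim e lam = (if e = 0 then of_nat N * (of_nat N - 1) / 2 + of_nat n / 2
      else of_nat N * (of_nat N + 1) / 2) - of_int (weight e n (row lam)) / 2"
    if part: "partition_of N lam" and n: "length lam \<le> n" for lam
  proof -
    let ?odds = "card {j. j < length lam \<and> odd (lam ! j)}"
    have "{j. j < length lam \<and> odd (lam ! j)} = {..<n} \<inter> {i. odd (row lam i)}"
      using n by (auto simp: row_def split: if_splits)
    then have odds: "of_nat ?odds = (\<Sum>i<n. of_bool (odd (row lam i)) :: int)"
      by (simp add: of_bool_def sum.If_cases)
    have evens: "(\<Sum>i<n. of_bool (even (row lam i)) :: int) = of_nat n - of_nat ?odds"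
      unfolding odds using sum_even_odd[of "row lam" n] by simp
    have w: "weight e n (row lam) = int (\<Sum>j=1..N. (height lam j)\<^sup>2) +
        (\<Sum>i<n. of_bool (even (e + row lam i)))"
      unfolding sum_height_squares[OF part n] weight_def by (simp add: sum.distrib algebra_simps)
    have "sum_list lam = N" using part by (simp add: partition_of_def)
    define S where "S = (\<Sum>j=1..N. (height lam j)\<^sup>2)"
    define C where "C = ?odds"
    have dim: "orbit_dim e lam = (if e = 0 then of_nat N * (of_nat N - 1) / 2 - (of_nat S - of_nat C) / 2
        else of_nat N * (of_nat N + 1) / 2 - (of_nat S + of_nat C) / 2)"
      unfolding orbit_dim_def \<open>sum_list lam = N\<close> Let_def S_def C_def ..
    consider "e = 0" | "e = 1" using e by linarith
    then show ?thesis
    proof cases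
      case 1
      then have "weight e n (row lam) = int S + (int n - int C)"
        unfolding w S_def C_def using evens by simp
      then show ?thesis
        unfolding dim using 1 by (simp add: diff_divide_distrib add_divide_distrib)
    next
      case 2
      then have "weight e n (row lam) = int S + int C"
        unfolding w S_def C_def odds by simp
      then show ?thesis
        unfolding dim using 2 by simp
    qed
  qed
  show ?thesis
    unfolding orbit_codim_def dim[OF part(1) n(1)] dim[OF part(2) n(2)]
    by (simp add: diff_divide_distrib)
qed

section \<open>The classification\<close>

lemma dom_less_iff_psum:
  "dom_less mu lam \<longleftrightarrow> mu \<noteq> lam \<and> (\<forall>t. psum (row mu) t \<le> psum (row lam) t)"
  unfolding dom_less_def sum_list_take_eq_psum[symmetric] by simp

lemma minimal_pair_rows:
  assumes min: "minimal_special_degeneration e f N lam mu"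
  obtains l where "minimal_pair e f l (row lam) (row mu)"
proof -
  have sp: "lam \<in> special_partitions e f N" "mu \<in> special_partitions e f N"
    and dom: "dom_less mu lam"
    and none: "\<And>nu. nu \<in> special_partitions e f N \<Longrightarrow> dom_less mu nu \<Longrightarrow> dom_less nu lam \<Longrightarrow> False"
    using min by (auto simp: minimal_special_degeneration_def)
  have part: "partition_of N lam" "partition_of N mu"
    using sp by (auto simp: special_partitions_def eps_partitions_def)
  have le: "psum (row mu) t \<le> psum (row lam) t" for t
    using dom by (simp add: dom_less_iff_psum)
  have total: "psum (row nu) t = int M" if "partition_of M nu" "length nu \<le> t" for nu M t
    using that unfolding sum_list_take_eq_psum[symmetric] by (simp add: partition_of_def)
  define l where "l = (LEAST i. row mu i \<noteq> row lam i)"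
  have "row mu \<noteq> row lam"
    using row_inject[OF part(2,1)] dom by (auto simp: dom_less_def)
  then have "\<exists>i. row mu i \<noteq> row lam i" by auto
  then have l: "row mu l \<noteq> row lam l" unfolding l_def by (rule LeastI_ex)
  have before: "row mu i = row lam i" if "i < l" for i
    using not_less_Least that unfolding l_def by blast
  have "psum (row mu) l = psum (row lam) l"
    using before by (intro psum_cong)
  then have less: "row mu l < row lam l"
    using le[of "Suc l"] l by simp
  have same: "psum (row mu) t = psum (row lam) t" if "t \<ge> max (length lam) (length mu)" for t
    using total[OF part(1), of t] total[OF part(2), of t] that by simp
  have "minimal_pair e f l (row lam) (row mu)"
  proof
    fix k
    assume k: "special_seq e f k" "\<And>t. psum (row mu) t \<le> psum k t" "\<And>t. psum k t \<le> psum (row lam) t"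
    obtain n where "k n = 0" and "\<And>i. k (Suc i) \<le> k i"
      using k(1) by (auto simp: special_seq_def)
    then obtain nu M where nu: "partition_of M nu" "row nu = k"
      using ex_partition_row by metis
    define t where "t = max (length nu) (max (length lam) (length mu))"
    have "M = N"
      using total[OF nu(1), of t] total[OF part(1), of t] k(2)[of t] k(3)[of t] same[of t] nu(2)
      by (simp add: t_def)
    then have "nu \<in> special_partitions e f N"
      using special_partitionsI[of N nu e f] nu k(1) by simp
    then have "\<not> (dom_less mu nu \<and> dom_less nu lam)"
      using none by blast
    then have "mu = nu \<or> nu = lam"
      using k(2,3) nu(2) by (auto simp: dom_less_iff_psum)
    then show "k = row mu \<or> k = row lam"
      using nu(2) by auto
  next
    show "\<exists>T. \<forall>t\<ge>T. psum (row mu) t = psum (row lam) t"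
      using same by blast
  qed (use special_seq_row[OF sp(1)] special_seq_row[OF sp(2)] le before less in auto)
  then show ?thesis by (rule that)
qed

theorem theorem3p1:
  fixes \<epsilon> \<epsilon>' N l s :: nat and lam mu lam_bar mu_bar :: "nat list"
  assumes "(\<epsilon>, \<epsilon>') \<in> {(0, 1), (1, 0), (0, 0), (1, 1)}"
    and "minimal_special_degeneration \<epsilon> \<epsilon>' N lam mu"
    and "l = common_rows lam mu"
    and "s = common_cols (drop l lam) (drop l mu)"
    and "lam_bar = remove_cols s (drop l lam)"
    and "mu_bar = remove_cols s (drop l mu)"
  shows "(\<exists>!t. is_entry t \<epsilon> \<epsilon>' l s lam_bar mu_bar) \<and>
    (\<forall>t. is_entry t \<epsilon> \<epsilon>' l s lam_bar mu_bar \<longrightarrow>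
      (case ambient t of (\<epsilon>_bar, M) \<Rightarrow>
         [\<epsilon>_bar = \<epsilon> + s] (mod 2) \<and>
         lam_bar \<in> eps_partitions \<epsilon>_bar M \<and> mu_bar \<in> eps_partitions \<epsilon>_bar M) \<and>
      (if codim_two_type t then orbit_codim \<epsilon> lam mu = 2 else orbit_codim \<epsilon> lam mu \<ge> 4))"
proof -
  have part: "partition_of N lam" "partition_of N mu"
    using assms(2)
    by (auto simp: minimal_special_degeneration_def special_partitions_def eps_partitions_def)
  obtain l' where "minimal_pair \<epsilon> \<epsilon>' l' (row lam) (row mu)"
    using minimal_pair_rows[OF assms(2)] .
  then interpret minimal_pair \<epsilon> \<epsilon>' l' "row lam" "row mu" .
  have l: "l' = l"
    using common_rows_eqI[OF part common differ] assms(3) by simp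
  obtain t s' xs ys where entry: "is_entry t \<epsilon> \<epsilon>' l s' xs ys"
    and red: "reduces_to l s' (row lam) (row mu) xs ys"
    and codim: "\<And>n. l + length ys \<le> n \<Longrightarrow> if codim_two_type t
       then weight \<epsilon> n (row mu) - weight \<epsilon> n (row lam) = 4
       else 8 \<le> weight \<epsilon> n (row mu) - weight \<epsilon> n (row lam)"
    using classified_minimal_pair unfolding classified_def l by blast
  have s: "s' = s"
    using common_cols_reduces_to[OF part red] assms(4) by simp
  have bars: "lam_bar = xs" "mu_bar = ys"
    using remove_cols_reduces_to[OF part red] assms(5,6) s by simp_all
  have unique: "t' = t" if "is_entry t' \<epsilon> \<epsilon>' l s lam_bar mu_bar" for t'
    using is_entry_unique[OF that] entry s bars by simp
  define n where "n = max (l + length ys) (max (length lam) (length mu))"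
  have "orbit_codim \<epsilon> lam mu = of_int (weight \<epsilon> n (row mu) - weight \<epsilon> n (row lam)) / 2"
    using assms(1) by (intro orbit_codim_weight[OF part]) (auto simp: n_def)
  then have dim: "if codim_two_type t then orbit_codim \<epsilon> lam mu = 2 else orbit_codim \<epsilon> lam mu \<ge> 4"
    using codim[of n] by (auto simp: n_def split: if_splits)
  have here: "is_entry t \<epsilon> \<epsilon>' l s lam_bar mu_bar"
    using entry s bars by simp
  note props = conjI[OF is_entry_ambient[OF here] dim]
  show ?thesis
    by (rule conjI, rule ex1I[of _ t], rule here, erule unique,
        intro allI impI, drule unique, hypsubst, rule props)
qed

end
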